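(* Let $K\in\mathcal D_1$ and let $L(\lambda)$ be the Lax matrix, regarded as a matrix of functions on $\mathbf R^{2n\times r}$ with coordinates $\phi_{j\sigma}$. For any $\lambda,\mu\in\mathbf C$ (for which both sides are defined) and all $a,b,c,d\in\{1,\dots,2n\}$, $$\{L_{ab}(\lambda),L_{cd}(\mu)\}=[r_1(\lambda,\mu),L(\lambda)\otimes I]_{abcd}+[r_2(\lambda,\mu),I\otimes L(\mu)]_{abcd},$$ where $$(r_1(\lambda,\mu))_{abcd}=\sum_{\gamma\in\Sigma_0}\frac{\kappa}{\mu-\omega^\gamma\lambda}\Big((\Omega^{-\gamma})_{ad}(\Omega^\gamma)_{cb}-(\Omega^{-\gamma}W^{-1})_{ac}(W\Omega^\gamma)_{db}\Big),$$ $$(r_2(\lambda,\mu))_{abcd}=\sum_{\gamma\in\Sigma_0}\frac{\kappa\,\omega^\gamma}{\mu-\omega^\gamma\lambda}\Big((\Omega^{-\gamma})_{ad}(\Omega^\gamma)_{cb}-(\Omega^{-\gamma}W^{-1})_{ac}(W\Omega^\gamma)_{db}\Big)=-(r_1(\mu,\lambda))_{cdab}.$$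
   Context: Algebraic setting. $W$ is a $2n\times 2n$ invertible antisymmetric real matrix. $G=\{A\in GL(2n,\mathbf C): A^TWA=W\}$ and $\mathfrak g=\{X\in gl(2n,\mathbf C): X^T=-WXW^{-1}\}$ is its Lie algebra. $\mathrm{pr}:G\to G/\{\pm I\}$ is the projection. $G_0$ is a finite subgroup of $G$ such that every $A\in G_0$ satisfies $\bar AA=\pm I$ (bar = entrywise complex conjugation); then $\mathrm{pr}(G_0)$ is Abelian. $\Omega_1,\dots,\Omega_N\in G_0$ are such that $\mathrm{pr}(\Omega_1),\dots,\mathrm{pr}(\Omega_N)$ generate $\mathrm{pr}(G_0)$, and $m_a$ is the order of $\mathrm{pr}(\Omega_a)$, so $\Omega_a^{m_a}=\pm I$. $\Sigma_0=\{\alpha=(\alpha_1,\dots,\alpha_N)\in\mathbf Z^N: 0\le\alpha_a<m_a\}$, $\Omega^\alpha=\Omega_1^{\alpha_1}\cdots\Omega_N^{\alpha_N}$ and, for $\gamma\in\Sigma_0$, $\Omega^{-\gamma}=(\Omega^\gamma)^{-1}$. $\omega:G_0\to S^1=\{z\in\mathbf C:|z|=1\}$ is a group homomorphism with $\omega(\pm I)=1$; $\omega_a=\omega(\Omega_a)$ and $\omega^\alpha=\omega_1^{\alpha_1}\cdots\omega_N^{\alpha_N}$. $\mathcal D_1=\{X\in\mathfrak g: \bar X=X,\ \Omega X\Omega^{-1}=\omega(\Omega)X\text{ for all }\Omega\in G_0\}$. Lax matrix. $\lambda_1,\dots,\lambda_r$ are non-zero real numbers with $\lambda_1^2,\dots,\lambda_r^2$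 distinct, $\kappa$ is a real constant, $\Phi_\sigma=(\phi_{1\sigma},\dots,\phi_{2n,\sigma})^T$ are real column vectors, and $$L(\lambda)=K+\kappa\sum_{\alpha\in\Sigma_0}\sum_{\sigma=1}^r\frac{\Omega^\alpha\Phi_\sigma\Phi_\sigma^T(\Omega^\alpha)^TW}{\lambda-\omega^\alpha\lambda_\sigma}.$$ Poisson bracket on $\mathbf R^{2n\times r}$ (extended complex-bilinearly to complex-valued functions): $\{f,g\}=\sum_{j,k=1}^{2n}\sum_{\sigma=1}^r(W^{-1})_{jk}\frac{\partial f}{\partial\phi_{j\sigma}}\frac{\partial g}{\partial\phi_{k\sigma}}$. Tensor notation: $(2n)^2\times(2n)^2$ matrices carry four indices, $(A\otimes B)_{abcd}=A_{ab}B_{cd}$, and $[A,B]_{abcd}=\sum_{p,q=1}^{2n}(A_{apcq}B_{pbqd}-B_{apcq}A_{pbqd})$. *)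

theory Defs
  imports "HOL-Analysis.Analysis" "HOL-Algebra.Generated_Groups" "HOL-Algebra.Multiplicative_Group"
begin

abbreviation cmat :: "real^'j^'i \<Rightarrow> complex^'j^'i" where
  "cmat \<equiv> map_matrix complex_of_real"

abbreviation scale_mat :: "complex \<Rightarrow> complex^'j^'i \<Rightarrow> complex^'j^'i" where
  "scale_mat c \<equiv> map_matrix (\<lambda>x. c * x)"

definition sp_group :: "real^'m^'m \<Rightarrow> (complex^'m^'m) monoid" where
  "sp_group W = \<lparr>carrier = {A. invertible A \<and> transpose A ** cmat W ** A = cmat W},
                 mult = (**), one = mat 1\<rparr>"

definition sp_algebra :: "real^'m^'m \<Rightarrow> (complex^'m^'m) set" where
  "sp_algebra W = {X. transpose X = - (cmat W ** X ** cmat (matrix_inv W))}"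

definition plus_minus_one :: "(complex^'m^'m) set" where
  "plus_minus_one = {mat 1, - mat 1}"

definition proj_group :: "real^'m^'m \<Rightarrow> (complex^'m^'m) set monoid" where
  "proj_group W = sp_group W Mod plus_minus_one"

definition pr :: "real^'m^'m \<Rightarrow> complex^'m^'m \<Rightarrow> (complex^'m^'m) set" where
  "pr W A = plus_minus_one #>\<^bsub>sp_group W\<^esub> A"

definition circle_group :: "complex monoid" where
  "circle_group = \<lparr>carrier = {z. cmod z = 1}, mult = (*), one = 1\<rparr>"

definition D1 :: "real^'m^'m \<Rightarrow> (complex^'m^'m) set \<Rightarrow> (complex^'m^'m \<Rightarrow> complex)
    \<Rightarrow> (complex^'m^'m) set" where
  "D1 W G0 \<omega> = {X \<in> sp_algebra W. map_matrix cnj X = X \<and>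
     (\<forall>A\<in>G0. A ** X ** matrix_inv A = scale_mat (\<omega> A) X)}"

text \<open>Multi-indices are extensional functions on \<open>{1..N}\<close>, so that each tuple
  is counted exactly once in sums over \<open>multi_indices N m\<close>.\<close>

definition multi_indices :: "nat \<Rightarrow> (nat \<Rightarrow> nat) \<Rightarrow> (nat \<Rightarrow> nat) set" where
  "multi_indices N m = (\<Pi>\<^sub>E a\<in>{1..N}. {..<m a})"

text \<open>The \<open>\<Omega> a\<close> need not commute; the factors are taken in increasing order of \<open>a\<close>.
  The operation \<open>^\<close> on \<open>complex^'m^'m\<close> is the entrywise power, hence the group power here.\<close>

definition mat_pow :: "real^'m^'m \<Rightarrow> nat \<Rightarrow> (nat \<Rightarrow> complex^'m^'m) \<Rightarrow> (nat \<Rightarrow> nat)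
    \<Rightarrow> complex^'m^'m" where
  "mat_pow W N \<Omega> \<alpha> =
     foldr (\<lambda>a B. (\<Omega> a [^]\<^bsub>sp_group W\<^esub> \<alpha> a) ** B) [1..<Suc N] (mat 1)"

definition char_pow :: "nat \<Rightarrow> (nat \<Rightarrow> complex^'m^'m) \<Rightarrow> (complex^'m^'m \<Rightarrow> complex)
    \<Rightarrow> (nat \<Rightarrow> nat) \<Rightarrow> complex" where
  "char_pow N \<Omega> \<omega> \<alpha> = (\<Prod>a\<in>{1..N}. \<omega> (\<Omega> a) ^ \<alpha> a)"

text \<open>\<open>\<Phi> $ j $ \<sigma>\<close> is the coordinate \<open>\<phi>\<^bsub>j\<sigma>\<^esub>\<close>, so \<open>\<Phi>\<^sub>\<sigma>\<close> is
  the column \<open>\<sigma>\<close> of the matrix \<open>\<Phi>\<close>.\<close>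

definition lax :: "real^'m^'m \<Rightarrow> nat \<Rightarrow> (nat \<Rightarrow> nat) \<Rightarrow> (nat \<Rightarrow> complex^'m^'m)
    \<Rightarrow> (complex^'m^'m \<Rightarrow> complex) \<Rightarrow> real \<Rightarrow> complex^'m^'m \<Rightarrow> ('r::finite \<Rightarrow> real)
    \<Rightarrow> complex \<Rightarrow> real^'r^'m \<Rightarrow> complex^'m^'m" where
  "lax W N m \<Omega> \<omega> \<kappa> K l z \<Phi> = K + scale_mat (of_real \<kappa>)
     (\<Sum>\<alpha>\<in>multi_indices N m. \<Sum>\<sigma>\<in>UNIV.
        scale_mat (1 / (z - char_pow N \<Omega> \<omega> \<alpha> * of_real (l \<sigma>)))
          (mat_pow W N \<Omega> \<alpha> ** cmat (\<chi> i j. \<Phi> $ i $ \<sigma> * \<Phi> $ j $ \<sigma>)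
             ** transpose (mat_pow W N \<Omega> \<alpha>) ** cmat W))"

definition partial_deriv :: "'m \<Rightarrow> 'r \<Rightarrow> (real^'r::finite^'m::finite \<Rightarrow> complex)
    \<Rightarrow> real^'r^'m \<Rightarrow> complex" where
  "partial_deriv j \<sigma> f \<Phi> =
     vector_derivative (\<lambda>t. f (\<Phi> + t *\<^sub>R axis j (axis \<sigma> 1))) (at 0)"

definition poisson :: "real^'m^'m \<Rightarrow> (real^'r::finite^'m::finite \<Rightarrow> complex)
    \<Rightarrow> (real^'r^'m \<Rightarrow> complex) \<Rightarrow> real^'r^'m \<Rightarrow> complex" where
  "poisson W f g \<Phi> = (\<Sum>j\<in>UNIV. \<Sum>k\<in>UNIV. \<Sum>\<sigma>\<in>UNIV.
     of_real (matrix_inv W $ j $ k) * partial_deriv j \<sigma> f \<Phi> * partial_deriv k \<sigma> g \<Phi>)"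

type_synonym 'm tensor = "'m \<Rightarrow> 'm \<Rightarrow> 'm \<Rightarrow> 'm \<Rightarrow> complex"

definition tensor_mat :: "complex^'m^'m \<Rightarrow> complex^'m^'m \<Rightarrow> 'm tensor" where
  "tensor_mat A B a b c d = A $ a $ b * B $ c $ d"

definition tensor_comm :: "('m::finite) tensor \<Rightarrow> 'm tensor \<Rightarrow> 'm tensor" where
  "tensor_comm A B a b c d =
     (\<Sum>p\<in>UNIV. \<Sum>q\<in>UNIV. A a p c q * B p b q d - B a p c q * A p b q d)"

definition r1 :: "real^'m^'m \<Rightarrow> nat \<Rightarrow> (nat \<Rightarrow> nat) \<Rightarrow> (nat \<Rightarrow> complex^'m^'m)
    \<Rightarrow> (complex^'m^'m \<Rightarrow> complex) \<Rightarrow> real \<Rightarrow> complex \<Rightarrow> complex \<Rightarrow> 'm tensor" where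
  "r1 W N m \<Omega> \<omega> \<kappa> z w a b c d = (\<Sum>\<gamma>\<in>multi_indices N m.
     (let P = mat_pow W N \<Omega> \<gamma>; Q = matrix_inv P in
       of_real \<kappa> / (w - char_pow N \<Omega> \<omega> \<gamma> * z) *
         (Q $ a $ d * P $ c $ b
          - (Q ** cmat (matrix_inv W)) $ a $ c * (cmat W ** P) $ d $ b)))"

definition r2 :: "real^'m^'m \<Rightarrow> nat \<Rightarrow> (nat \<Rightarrow> nat) \<Rightarrow> (nat \<Rightarrow> complex^'m^'m)
    \<Rightarrow> (complex^'m^'m \<Rightarrow> complex) \<Rightarrow> real \<Rightarrow> complex \<Rightarrow> complex \<Rightarrow> 'm tensor" where
  "r2 W N m \<Omega> \<omega> \<kappa> z w a b c d = (\<Sum>\<gamma>\<in>multi_indices N m.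
     (let P = mat_pow W N \<Omega> \<gamma>; Q = matrix_inv P in
       of_real \<kappa> * char_pow N \<Omega> \<omega> \<gamma> / (w - char_pow N \<Omega> \<omega> \<gamma> * z) *
         (Q $ a $ d * P $ c $ b
          - (Q ** cmat (matrix_inv W)) $ a $ c * (cmat W ** P) $ d $ b)))"

end

theory Submission
  imports Defs
begin

text \<open>
  For symplectic \<open>R\<close> let \<open>\<rho>(R)\<close> be the tensor \<open>r_core W R\<close>. Since \<open>W\<close>-symplecticity
  turns the bracket of the rank-one terms \<open>U(P) = P\<Phi>\<Phi>\<^sup>TP\<^sup>TW\<close> into products of entries of
  \<open>R\<close> and \<open>R\<^sup>-\<^sup>1\<close>, one has \<open>{U(P), U(RP)} = [\<rho>(R), U(P) \<otimes> I]\<close>; moreover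
  \<open>[\<rho>(R), X \<otimes> I] = - [\<rho>(R), I \<otimes> RXR\<^sup>-\<^sup>1]\<close> for \<open>X\<close> in the Lie algebra, which also makes the
  contribution of \<open>K\<close> vanish. Every expression is quadratic in \<open>\<Omega>\<^sup>\<alpha>\<close>, so the multi-indices may be
  added modulo the orders \<open>m\<close> even though \<open>\<Omega>\<^sup>\<alpha>\<Omega>\<^sup>\<gamma>\<close> and \<open>\<Omega>\<close> to the power of the sum agree only up to
  sign. Summing over \<open>\<beta> = \<alpha> + \<gamma>\<close>, the two poles are separated by
  \<open>1/(xy) = (1/x - \<omega>\<^sup>\<gamma>/y) / (\<mu> - \<omega>\<^sup>\<gamma>\<lambda>)\<close> with \<open>x = \<lambda> - \<omega>\<^sup>\<alpha>\<lambda>\<^sub>\<sigma>\<close> and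
  \<open>y = \<mu> - \<omega>\<^sup>\<beta>\<lambda>\<^sub>\<sigma>\<close>.
\<close>

subsection \<open>Matrices and tensors\<close>

lemma matrix_minus_left: "(- A) ** B = - (A ** B)" for A :: "'a::ring_1^'n^'m"
  by (simp add: vec_eq_iff matrix_matrix_mult_def sum_negf)

lemma matrix_minus_right: "A ** (- B) = - (A ** B)" for A :: "'a::ring_1^'n^'m"
  by (simp add: vec_eq_iff matrix_matrix_mult_def sum_negf)

lemma transpose_minus: "transpose (- A) = - transpose A" for A :: "'a::ab_group_add^'n^'m"
  by (simp add: vec_eq_iff transpose_def)

lemma matrix_vector_minus_left: "(- A) *v x = - (A *v x)" for A :: "'a::ring_1^'n^'m"
  by (simp add: vec_eq_iff matrix_vector_mult_def sum_negf)

lemma matrix_vector_minus_right: "A *v (- x) = - (A *v x)" for A :: "'a::ring_1^'n^'m"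
  by (simp add: vec_eq_iff matrix_vector_mult_def sum_negf)

lemmas matrix_minus = matrix_minus_left matrix_minus_right transpose_minus
  matrix_vector_minus_left matrix_vector_minus_right

lemma matrix_inv_unique:
  fixes A B :: "'a::comm_ring_1^'n^'n"
  assumes "A ** B = mat 1" "B ** A = mat 1"
  shows "matrix_inv A = B"
proof -
  have "invertible A" using assms invertible_def by blast
  then have "A ** matrix_inv A = mat 1 \<and> matrix_inv A ** A = mat 1"
    unfolding invertible_def matrix_inv_def by (rule someI_ex)
  then show ?thesis
    using assms by (metis matrix_mul_assoc matrix_mul_lid matrix_mul_rid)
qed

lemma invertible_matrix_inv:
  fixes A :: "'a::comm_ring_1^'n^'n"
  assumes "invertible A"
  shows "A ** matrix_inv A = mat 1" "matrix_inv A ** A = mat 1"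
  using assms unfolding invertible_def matrix_inv_def by (metis (mono_tags, lifting) someI_ex)+

lemma cmat_mult: "cmat (A ** B) = cmat A ** cmat B"
  by (simp add: vec_eq_iff matrix_matrix_mult_def)

lemma cmat_one: "cmat (mat 1) = mat 1"
  by (simp add: vec_eq_iff mat_def)

lemma scale_mat_mult_left: "scale_mat c A ** B = scale_mat c (A ** B)"
  by (simp add: vec_eq_iff matrix_matrix_mult_def sum_distrib_left mult.assoc)

lemma scale_mat_mult_right: "A ** scale_mat c B = scale_mat c (A ** B)"
  by (simp add: vec_eq_iff matrix_matrix_mult_def sum_distrib_left algebra_simps)

text \<open>For R = 1 this is, up to normalisation, the split Casimir tensor of the symplectic Lie
  algebra: the permutation operator minus its \<open>W\<close>-twisted partial transpose. A general
  \<open>R\<close> twists it, and \<open>r1\<close> and \<open>r2\<close> are scalar combinations of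
  these tensors.\<close>

definition r_core :: "real^'m^'m \<Rightarrow> complex^'m^'m \<Rightarrow> 'm::finite tensor" where
  "r_core W R a b c d = matrix_inv R $ a $ d * R $ c $ b
     - (matrix_inv R ** cmat (matrix_inv W)) $ a $ c * (cmat W ** R) $ d $ b"

definition lax_term :: "real^'m^'m \<Rightarrow> complex^'m^'m \<Rightarrow> real^'m \<Rightarrow> complex^'m^'m" where
  "lax_term W P v = P ** cmat (\<chi> i j. v $ i * v $ j) ** transpose P ** cmat W"

text \<open>The Leibniz rule along the j-th coordinate: with x the complexified vector, entry (a, b)
  of \<open>lax_term W P v\<close> is component a of P x times component b of -(W P) x.\<close>

definition lax_term_deriv ::
    "real^'m^'m \<Rightarrow> complex^'m^'m \<Rightarrow> real^'m \<Rightarrow> 'm \<Rightarrow> 'm \<Rightarrow> 'm \<Rightarrow> complex" where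
  "lax_term_deriv W P v j a b =
     P $ a $ j * (- (cmat W ** P) *v (\<chi> i. complex_of_real (v $ i))) $ b
   + (P *v (\<chi> i. complex_of_real (v $ i))) $ a * (- (cmat W ** P)) $ b $ j"

section \<open>Tensor commutators with sums and with one-sided tensors\<close>

lemma tensor_comm_sum_left:
  "tensor_comm (\<lambda>a b c d. \<Sum>i\<in>I. s i * A i a b c d) B a b c d
     = (\<Sum>i\<in>I. s i * tensor_comm (A i) B a b c d)"
proof -
  have "tensor_comm (\<lambda>a b c d. \<Sum>i\<in>I. s i * A i a b c d) B a b c d
     = (\<Sum>p\<in>UNIV. \<Sum>q\<in>UNIV. \<Sum>i\<in>I. s i * (A i a p c q * B p b q d - B a p c q * A i p b q d))"
    unfolding tensor_comm_def
    by (simp add: sum_distrib_left sum_distrib_right sum_subtractf algebra_simps)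
  also have "\<dots> = (\<Sum>p\<in>UNIV. \<Sum>i\<in>I. \<Sum>q\<in>UNIV. s i * (A i a p c q * B p b q d - B a p c q * A i p b q d))"
    by (rule sum.cong[OF refl], rule sum.swap)
  also have "\<dots> = (\<Sum>i\<in>I. \<Sum>p\<in>UNIV. \<Sum>q\<in>UNIV. s i * (A i a p c q * B p b q d - B a p c q * A i p b q d))"
    by (rule sum.swap)
  finally show ?thesis by (simp add: tensor_comm_def sum_distrib_left)
qed

lemma sum_mult_mat_one:
  fixes d :: "'n::finite" and x :: "'a::comm_ring_1"
  shows "(\<Sum>q\<in>UNIV. f q * (x * mat 1 $ q $ d)) = f d * x"
    and "(\<Sum>q\<in>UNIV. x * mat 1 $ d $ q * f q) = x * f d"
    and "(\<Sum>q\<in>UNIV. f q * (mat 1 $ q $ d * x)) = f d * x"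
    and "(\<Sum>q\<in>UNIV. mat 1 $ d $ q * x * f q) = x * f d"
proof -
  have *: "x * mat 1 $ q $ d = (if q = d then x else 0)"
    "x * mat 1 $ d $ q = (if q = d then x else 0)"
    "mat 1 $ q $ d * x = (if q = d then x else 0)"
    "mat 1 $ d $ q * x = (if q = d then x else 0)" for q
    by (auto simp: mat_def)
  show "(\<Sum>q\<in>UNIV. f q * (x * mat 1 $ q $ d)) = f d * x"
    "(\<Sum>q\<in>UNIV. x * mat 1 $ d $ q * f q) = x * f d"
    "(\<Sum>q\<in>UNIV. f q * (mat 1 $ q $ d * x)) = f d * x"
    "(\<Sum>q\<in>UNIV. mat 1 $ d $ q * x * f q) = x * f d"
    unfolding * by (simp_all add: if_distrib[of "\<lambda>y. y * _"] if_distrib[of "\<lambda>y. _ * y"]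
      sum.delta cong: if_cong)
qed

lemma tensor_comm_mat_left:
  "tensor_comm A (tensor_mat X (mat 1)) a b c d
     = (\<Sum>p\<in>UNIV. A a p c d * X $ p $ b - X $ a $ p * A p b c d)"
  unfolding tensor_comm_def tensor_mat_def sum_subtractf
  by (simp add: sum_mult_mat_one)

lemma tensor_comm_mat_right:
  "tensor_comm A (tensor_mat (mat 1) X) a b c d
     = (\<Sum>q\<in>UNIV. A a b c q * X $ q $ d - X $ c $ q * A a b q d)"
  unfolding tensor_comm_def tensor_mat_def
  by (subst sum.swap) (simp add: sum_subtractf sum_mult_mat_one)

lemma matrix_mult_entry: "(A ** B) $ i $ j = (\<Sum>k\<in>UNIV. A $ i $ k * B $ k $ j)"
  by (simp add: matrix_matrix_mult_def)

lemma transpose_entry: "transpose A $ i $ j = A $ j $ i"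
  by (simp add: transpose_def)

text \<open>With \<open>J\<close> the inverse of \<open>W\<close>, the right-hand side is the
  Poisson pairing of a row of \<open>A\<close> with a row of \<open>B\<close>.\<close>

lemma congruence_entry:
  "(A ** J ** transpose B) $ a $ c = (\<Sum>j\<in>UNIV. \<Sum>k\<in>UNIV. J $ j $ k * A $ a $ j * B $ c $ k)"
  for A :: "'a::comm_ring_1^'n^'m" and B :: "'a^'l^'k"
  unfolding matrix_matrix_mult_def transpose_def
  by (simp add: sum_distrib_left sum_distrib_right algebra_simps) (rule sum.swap)

subsection \<open>The symplectic group and the r-matrix\<close>

locale symplectic_form =
  fixes W :: "real^'m::finite^'m"
  assumes invertible_W: "invertible W" and skew_W: "transpose W = - W"
begin

abbreviation "V \<equiv> cmat W"
abbreviation "J \<equiv> cmat (matrix_inv W)"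

lemma V_J: "V ** J = mat 1" and J_V: "J ** V = mat 1"
  by (simp_all add: invertible_matrix_inv[OF invertible_W] cmat_one flip: cmat_mult)

lemma transpose_V: "transpose V = - V"
proof -
  have "transpose V = cmat (transpose W)" by (simp add: vec_eq_iff transpose_def)
  also have "\<dots> = - V" unfolding skew_W by (simp add: vec_eq_iff)
  finally show ?thesis .
qed

lemma transpose_J: "transpose J = - J"
proof -
  have "transpose (V ** J) = mat 1" by (simp add: V_J transpose_mat)
  then have "transpose J ** V = - mat 1"
    by (simp add: matrix_transpose_mul transpose_V matrix_minus) (metis minus_minus)
  then have "transpose J ** (V ** J) = - J"
    by (simp add: matrix_mul_assoc matrix_minus)
  then show ?thesis by (simp add: V_J)
qed

definition symplectic :: "complex^'m^'m \<Rightarrow> bool" where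
  "symplectic A \<longleftrightarrow> invertible A \<and> transpose A ** V ** A = V"

lemma symplectic_inv:
  assumes "symplectic A"
  shows "A ** matrix_inv A = mat 1" "matrix_inv A ** A = mat 1"
  using assms invertible_matrix_inv unfolding symplectic_def by auto

lemma symplectic_transpose: "transpose A = V ** matrix_inv A ** J" if "symplectic A"
proof -
  have "transpose A = transpose A ** (V ** (A ** matrix_inv A) ** J)"
    by (simp add: symplectic_inv[OF that] V_J)
  also have "\<dots> = (transpose A ** V ** A) ** matrix_inv A ** J"
    by (simp add: matrix_mul_assoc)
  finally show ?thesis using that by (simp add: symplectic_def)
qed

text \<open>A symplectic matrix also preserves the inverse form, that is, the Poisson
  tensor.\<close>

lemma symplectic_congruence_J: "A ** J ** transpose A = J" if "symplectic A"
proof -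
  have "A ** J ** transpose A = A ** (J ** V) ** matrix_inv A ** J"
    by (simp add: symplectic_transpose[OF that] matrix_mul_assoc)
  then show ?thesis by (simp add: J_V symplectic_inv[OF that])
qed

lemma symplectic_mult: "symplectic (A ** B)" if "symplectic A" "symplectic B"
proof -
  have "transpose (A ** B) ** V ** (A ** B) = transpose B ** (transpose A ** V ** A) ** B"
    by (simp add: matrix_transpose_mul matrix_mul_assoc)
  then show ?thesis
    using that by (simp add: symplectic_def invertible_mult)
qed

lemma symplectic_uminus: "symplectic (- A)" if "symplectic A"
  using that symplectic_inv[OF that] unfolding symplectic_def invertible_def
  by (auto simp: matrix_minus intro!: exI[of _ "- matrix_inv A"])

lemma symplectic_matrix_inv: "symplectic (matrix_inv A)" if "symplectic A"
proof -
  let ?B = "matrix_inv A"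
  note inv = symplectic_inv[OF that]
  have "transpose ?B ** V ** ?B = transpose ?B ** (transpose A ** V ** A) ** ?B"
    using that by (simp add: symplectic_def)
  also have "\<dots> = transpose (A ** ?B) ** V ** (A ** ?B)"
    by (simp only: matrix_transpose_mul matrix_mul_assoc)
  finally show ?thesis
    using inv by (auto simp: symplectic_def invertible_def transpose_mat)
qed

lemma symplectic_one: "symplectic (mat 1)"
  by (simp add: symplectic_def invertible_def transpose_mat)

section \<open>Commutators with the core tensor\<close>

lemma tensor_comm_r_core_left:
  "tensor_comm (r_core W R) (tensor_mat X (mat 1)) a b c d =
     matrix_inv R $ a $ d * (R ** X) $ c $ b
   - (matrix_inv R ** J) $ a $ c * (V ** R ** X) $ d $ b
   - (X ** matrix_inv R) $ a $ d * R $ c $ b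
   + (X ** (matrix_inv R ** J)) $ a $ c * (V ** R) $ d $ b"
proof -
  have "tensor_comm (r_core W R) (tensor_mat X (mat 1)) a b c d =
     matrix_inv R $ a $ d * (\<Sum>p\<in>UNIV. R $ c $ p * X $ p $ b)
   - (matrix_inv R ** J) $ a $ c * (\<Sum>p\<in>UNIV. (V ** R) $ d $ p * X $ p $ b)
   - (\<Sum>p\<in>UNIV. X $ a $ p * matrix_inv R $ p $ d) * R $ c $ b
   + (\<Sum>p\<in>UNIV. X $ a $ p * (matrix_inv R ** J) $ p $ c) * (V ** R) $ d $ b"
    unfolding tensor_comm_mat_left r_core_def
    by (simp add: sum_subtractf sum.distrib sum_distrib_left sum_distrib_right algebra_simps)
  then show ?thesis
    by (simp only: matrix_mult_entry[of R X] matrix_mult_entry[of "V ** R" X]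
        matrix_mult_entry[of X])
qed

lemma tensor_comm_r_core_right:
  "tensor_comm (r_core W R) (tensor_mat (mat 1) X) a b c d =
     (matrix_inv R ** X) $ a $ d * R $ c $ b
   - (matrix_inv R ** J) $ a $ c * (transpose X ** (V ** R)) $ d $ b
   - matrix_inv R $ a $ d * (X ** R) $ c $ b
   + (matrix_inv R ** J ** transpose X) $ a $ c * (V ** R) $ d $ b"
proof -
  have "tensor_comm (r_core W R) (tensor_mat (mat 1) X) a b c d =
     (\<Sum>q\<in>UNIV. matrix_inv R $ a $ q * X $ q $ d) * R $ c $ b
   - (matrix_inv R ** J) $ a $ c * (\<Sum>q\<in>UNIV. X $ q $ d * (V ** R) $ q $ b)
   - matrix_inv R $ a $ d * (\<Sum>q\<in>UNIV. X $ c $ q * R $ q $ b)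
   + (\<Sum>q\<in>UNIV. (matrix_inv R ** J) $ a $ q * X $ c $ q) * (V ** R) $ d $ b"
    unfolding tensor_comm_mat_right r_core_def
    by (simp add: sum_subtractf sum.distrib sum_distrib_left sum_distrib_right algebra_simps)
  then show ?thesis
    by (simp add: matrix_mult_entry[of "matrix_inv R" X] matrix_mult_entry[of X R]
        matrix_mult_entry[of "transpose X"] matrix_mult_entry[of _ "transpose X"]
        transpose_entry)
qed

text \<open>Here \<open>Y\<close> is R X R^-1. Moving \<open>Y\<close> past R or R^-1, and replacing
  its transpose by -W Y W^-1, turns each of the four terms of the right commutator into the negative
  of a term of the left one.\<close>

lemma r_core_intertwines:
  assumes R: "symplectic R" and Y: "Y \<in> sp_algebra W" and RX: "R ** X = Y ** R"
  shows "tensor_comm (r_core W R) (tensor_mat (mat 1) Y) a b c d =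
    - tensor_comm (r_core W R) (tensor_mat X (mat 1)) a b c d"
proof -
  let ?Q = "matrix_inv R"
  note Q = symplectic_inv[OF R]
  have QY: "?Q ** Y = X ** ?Q"
  proof -
    have "?Q ** (R ** X) ** ?Q = ?Q ** (Y ** R) ** ?Q" by (simp only: RX)
    then have "(?Q ** R) ** X ** ?Q = ?Q ** Y ** (R ** ?Q)" by (simp only: matrix_mul_assoc)
    then show ?thesis by (simp add: Q)
  qed
  have tY: "transpose Y = - (V ** Y ** J)"
    using Y by (simp add: sp_algebra_def)
  have "transpose Y ** V ** R = - (V ** R ** X)"
  proof -
    have "transpose Y ** V ** R = - (V ** (Y ** (J ** V) ** R))"
      unfolding tY by (simp add: matrix_minus matrix_mul_assoc)
    then show ?thesis by (simp add: J_V RX[symmetric] matrix_mul_assoc)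
  qed
  moreover have "?Q ** J ** transpose Y = - (X ** ?Q ** J)"
  proof -
    have "?Q ** J ** transpose Y = - (?Q ** (J ** V) ** Y ** J)"
      unfolding tY by (simp add: matrix_minus matrix_mul_assoc)
    then show ?thesis by (simp add: J_V QY)
  qed
  ultimately show ?thesis
    unfolding tensor_comm_r_core_left tensor_comm_r_core_right by (simp add: QY RX matrix_mul_assoc)
qed

text \<open>The matrix of products v_i v_j has rank one, and antisymmetry of \<open>W\<close> lets
  the trailing factors be read as the transpose of -(W P).\<close>

lemma lax_term_entry:
  "lax_term W P v $ a $ b =
     (P *v (\<chi> i. complex_of_real (v $ i))) $ a *
     (- (V ** P) *v (\<chi> i. complex_of_real (v $ i))) $ b"
proof -
  let ?v = "\<chi> i. complex_of_real (v $ i)"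
  have tVP: "transpose P ** V = - transpose (V ** P)"
    by (simp add: matrix_transpose_mul transpose_V matrix_minus)
  have "lax_term W P v $ a $ b = (P ** cmat (\<chi> i j. v $ i * v $ j) ** transpose (- (V ** P))) $ a $ b"
    unfolding lax_term_def by (simp add: tVP transpose_minus flip: matrix_mul_assoc)
  also have "\<dots> = (\<Sum>j\<in>UNIV. \<Sum>k\<in>UNIV. (P $ a $ j * ?v $ j) * ((- (V ** P)) $ b $ k * ?v $ k))"
    unfolding congruence_entry by (simp add: algebra_simps)
  also have "\<dots> = (P *v ?v) $ a * (- (V ** P) *v ?v) $ b"
    unfolding matrix_vector_mult_def by (simp add: sum_product)
  finally show ?thesis .
qed

text \<open>For symmetric S the transpose of S W is -W S, which equals -W (S W) W^-1; here S is P v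
  v^T P^T.\<close>

lemma lax_term_sp_algebra: "lax_term W P v \<in> sp_algebra W"
proof -
  let ?M = "cmat (\<chi> i j. v $ i * v $ j)"
  have "transpose ?M = ?M"
    by (simp add: vec_eq_iff transpose_def mult.commute)
  then have "transpose (lax_term W P v) = - (V ** (P ** ?M ** transpose P))"
    by (simp add: lax_term_def matrix_transpose_mul transpose_V matrix_minus matrix_mul_assoc)
  also have "\<dots> = - (V ** lax_term W P v ** J)"
    by (simp add: lax_term_def V_J flip: matrix_mul_assoc)
  finally show ?thesis by (simp add: sp_algebra_def)
qed

text \<open>Replacing \<open>P\<close> by R P amounts to conjugation by \<open>R\<close>, because
  the factor R^T W R that arises collapses to W.\<close>

lemma lax_term_equivariant:
  assumes R: "symplectic R"
  shows "lax_term W (R ** P) v ** R = R ** lax_term W P v"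
proof -
  let ?M = "cmat (\<chi> i j. v $ i * v $ j)"
  have "lax_term W (R ** P) v ** R = R ** (P ** ?M ** transpose P ** (transpose R ** V ** R))"
    by (simp add: lax_term_def matrix_transpose_mul matrix_mul_assoc)
  also have "transpose R ** V ** R = V" using R by (simp add: symplectic_def)
  finally show ?thesis by (simp add: lax_term_def)
qed

text \<open>Two Leibniz terms in each derivative give four Poisson pairings of rows. Each is an
  entry of a product A J B^T that simplifies to an expression in \<open>R\<close> and
  \<open>W\<close> alone; the remaining factors are those that the left commutator produces on a
  rank-one matrix.\<close>

lemma lax_term_deriv_bracket:
  assumes R: "symplectic R" and P: "symplectic P"
  shows "(\<Sum>j\<in>UNIV. \<Sum>k\<in>UNIV. of_real (matrix_inv W $ j $ k) *
            lax_term_deriv W P v j a b * lax_term_deriv W (R ** P) v k c d)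
    = tensor_comm (r_core W R) (tensor_mat (lax_term W P v) (mat 1)) a b c d"
proof -
  let ?Q = "matrix_inv R" and ?x = "\<chi> i. complex_of_real (v $ i)"
  let ?P' = "R ** P" and ?S = "- (V ** P)" and ?S' = "- (V ** (R ** P))"
  note Q = symplectic_inv[OF R]
  have tR: "transpose R = V ** ?Q ** J" by (rule symplectic_transpose[OF R])
  define f where "f = P *v ?x" define g where "g = ?S *v ?x"
  define f' where "f' = ?P' *v ?x" define g' where "g' = ?S' *v ?x"
  \<comment> \<open>\<open>P\<close> drops out through P J P^T = J, so this pairing, and the other
    three derived from it, depend only on \<open>R\<close>.\<close>
  have PP': "P ** J ** transpose ?P' = ?Q ** J"
  proof -
    have "P ** J ** transpose ?P' = (P ** J ** transpose P) ** V ** ?Q ** J"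
      by (simp add: matrix_transpose_mul tR matrix_mul_assoc)
    then show ?thesis by (simp add: symplectic_congruence_J[OF P] J_V)
  qed
  have tS': "transpose ?S' = transpose ?P' ** V"
    by (simp add: matrix_transpose_mul transpose_V matrix_minus)
  have PS': "P ** J ** transpose ?S' = ?Q"
  proof -
    have "P ** J ** transpose ?S' = P ** J ** transpose ?P' ** V"
      unfolding tS' by (simp add: matrix_mul_assoc)
    then show ?thesis unfolding PP' by (simp add: J_V flip: matrix_mul_assoc)
  qed
  have SP': "?S ** J ** transpose ?P' = - transpose R"
  proof -
    have "?S ** J ** transpose ?P' = - (V ** (P ** J ** transpose ?P'))"
      by (simp add: matrix_minus matrix_mul_assoc)
    then show ?thesis unfolding PP' by (simp add: tR matrix_mul_assoc)
  qed
  have tVR: "transpose R ** V = - transpose (V ** R)"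
    by (simp add: matrix_transpose_mul transpose_V matrix_minus)
  have VQ: "V ** ?Q = transpose R ** V"
    unfolding tR by (simp add: J_V flip: matrix_mul_assoc)
  have SS': "?S ** J ** transpose ?S' = transpose (V ** R)"
  proof -
    have "?S ** J ** transpose ?S' = - (V ** (P ** J ** transpose ?S'))"
      by (simp add: matrix_minus matrix_mul_assoc)
    then show ?thesis unfolding PS' by (simp add: VQ tVR)
  qed
  let ?D = "\<lambda>A B i k. \<Sum>s\<in>UNIV. \<Sum>t\<in>UNIV. J $ s $ t * A $ i $ s * B $ k $ t"
  have "(\<Sum>j\<in>UNIV. \<Sum>k\<in>UNIV. of_real (matrix_inv W $ j $ k) *
            lax_term_deriv W P v j a b * lax_term_deriv W ?P' v k c d)
    = g $ b * g' $ d * ?D P ?P' a c + g $ b * f' $ c * ?D P ?S' a d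
    + f $ a * g' $ d * ?D ?S ?P' b c + f $ a * f' $ c * ?D ?S ?S' b d"
    unfolding lax_term_deriv_def f_def[symmetric] g_def[symmetric] f'_def[symmetric] g'_def[symmetric]
    unfolding sum_distrib_left sum.distrib[symmetric]
    by (intro sum.cong refl) (simp add: algebra_simps)
  also have "\<dots> = g $ b * g' $ d * (?Q ** J) $ a $ c + g $ b * f' $ c * ?Q $ a $ d
     - f $ a * g' $ d * R $ c $ b + f $ a * f' $ c * (V ** R) $ d $ b"
    unfolding congruence_entry[symmetric] PP' PS' SP' SS' by (simp add: transpose_def)
  finally have lhs: "(\<Sum>j\<in>UNIV. \<Sum>k\<in>UNIV. of_real (matrix_inv W $ j $ k) *
            lax_term_deriv W P v j a b * lax_term_deriv W ?P' v k c d) = \<dots>" .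
  let ?X = "lax_term W P v"
  have X: "?X $ i $ k = f $ i * g $ k" for i k
    unfolding f_def g_def by (rule lax_term_entry)
  \<comment> \<open>Multiplying a rank-one matrix from one side changes only the factor on that
    side.\<close>
  have left: "(A ** ?X) $ i $ k = (A *v f) $ i * g $ k" for A :: "complex^'m^'m" and i k
    by (simp add: matrix_matrix_mult_def matrix_vector_mult_def X sum_distrib_right mult.assoc)
  have right: "(?X ** A) $ i $ k = f $ i * (transpose A *v g) $ k" for A :: "complex^'m^'m" and i k
    by (simp add: matrix_matrix_mult_def matrix_vector_mult_def transpose_def X sum_distrib_left
        algebra_simps)
  have Rf: "R *v f = f'"
    by (simp add: f_def f'_def matrix_vector_mul_assoc)
  have Vf: "(V ** R) *v f = - g'"
    by (simp add: f_def g'_def matrix_vector_mul_assoc matrix_minus matrix_mul_assoc)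
  \<comment> \<open>The symplectic condition on \<open>R\<close>, multiplied from the left by the
    transposed inverse, is what carries \<open>g\<close> to \<open>g'\<close>.\<close>
  have tQ: "transpose ?Q ** V = V ** R"
  proof -
    have "transpose ?Q ** transpose R = mat 1"
      by (simp add: Q transpose_mat flip: matrix_transpose_mul)
    moreover have "transpose ?Q ** V = transpose ?Q ** (transpose R ** V ** R)"
      using R by (simp add: symplectic_def)
    ultimately show ?thesis by (simp add: matrix_mul_assoc)
  qed
  have Qg: "transpose ?Q *v g = g'"
    using tQ
    by (simp add: g_def g'_def matrix_vector_mul_assoc matrix_minus matrix_mul_assoc)
  have QJg: "transpose (?Q ** J) *v g = f'"
  proof -
    have "transpose (?Q ** J) *v g = - (J *v g')"
      by (simp add: matrix_transpose_mul transpose_J matrix_minus Qg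
        del: transpose_matrix_vector flip: matrix_vector_mul_assoc)
    also have "\<dots> = (J ** V) *v f'"
      by (simp add: g'_def f'_def matrix_vector_mul_assoc matrix_minus matrix_mul_assoc)
    finally show ?thesis by (simp add: J_V)
  qed
  show ?thesis
    unfolding lhs tensor_comm_r_core_left
    unfolding left right Rf Vf Qg QJg
    by (simp add: algebra_simps)
qed

section \<open>Invariance under a change of sign\<close>

lemma matrix_inv_uminus: "matrix_inv (- A) = - matrix_inv A" if "symplectic A"
  by (rule matrix_inv_unique) (simp_all add: matrix_minus symplectic_inv[OF that])

lemma r_core_uminus: "r_core W (- R) = r_core W R" if "symplectic R"
  by (intro ext) (simp add: r_core_def matrix_inv_uminus[OF that] matrix_minus)

lemma lax_term_uminus: "lax_term W (- P) v = lax_term W P v"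
  by (simp add: lax_term_def matrix_minus)

lemma lax_term_deriv_uminus: "lax_term_deriv W (- P) v = lax_term_deriv W P v"
  by (intro ext) (simp add: lax_term_deriv_def matrix_minus)

text \<open>Exchanging the tensor factors inverts \<open>R\<close>. The first product is symmetric
  at once; in the second, both factors become transposes with a minus sign, and the two signs
  cancel.\<close>

lemma r_core_swap:
  assumes "symplectic R"
  shows "r_core W (matrix_inv R) c d a b = r_core W R a b c d"
proof -
  let ?Q = "matrix_inv R"
  note Q = symplectic_inv[OF assms]
  have QQ: "matrix_inv ?Q = R" using Q by (intro matrix_inv_unique)
  have "R ** J = - transpose (?Q ** J)"
  proof -
    have "symplectic ?Q" by (rule symplectic_matrix_inv[OF assms])
    from symplectic_transpose[OF this] have "transpose ?Q = V ** R ** J"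
      by (simp add: QQ)
    then show ?thesis
      by (simp add: J_V matrix_transpose_mul transpose_J matrix_minus matrix_mul_assoc)
  qed
  moreover have "V ** ?Q = - transpose (V ** R)"
    by (simp add: matrix_transpose_mul transpose_V matrix_minus symplectic_transpose[OF assms] J_V
        flip: matrix_mul_assoc)
  ultimately show ?thesis
    unfolding r_core_def QQ by (simp add: transpose_def)
qed

end

subsection \<open>The reduction group\<close>

text \<open>Equality modulo {I, -I}, stated on representatives so that cosets need not be carried
  through the calculations.\<close>

definition up_to_sign :: "'a::ab_group_add \<Rightarrow> 'a \<Rightarrow> bool" where
  "up_to_sign x y \<longleftrightarrow> x = y \<or> x = - y"

lemma up_to_sign_refl: "up_to_sign x x"
  by (simp add: up_to_sign_def)

lemma up_to_sign_sym: "up_to_sign x y \<Longrightarrow> up_to_sign y x"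
  by (auto simp: up_to_sign_def)

lemma up_to_sign_trans [trans]: "up_to_sign x y \<Longrightarrow> up_to_sign y z \<Longrightarrow> up_to_sign x z"
  by (auto simp: up_to_sign_def)

lemma up_to_sign_mult:
  fixes A B C D :: "'a::ring_1^'n^'n"
  assumes "up_to_sign A B" "up_to_sign C D"
  shows "up_to_sign (A ** C) (B ** D)"
  using assms by (auto simp: up_to_sign_def matrix_minus)

context symplectic_form
begin

lemma carrier_sp_group: "carrier (sp_group W) = Collect symplectic"
  by (auto simp: sp_group_def symplectic_def)

lemma mult_sp_group: "A \<otimes>\<^bsub>sp_group W\<^esub> B = A ** B"
  and one_sp_group: "\<one>\<^bsub>sp_group W\<^esub> = mat 1"
  by (simp_all add: sp_group_def)

lemmas sp_group_simps = carrier_sp_group mult_sp_group one_sp_group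

lemma group_sp_group: "group (sp_group W)"
proof (rule groupI)
  show "\<exists>y\<in>carrier (sp_group W). y \<otimes>\<^bsub>sp_group W\<^esub> x = \<one>\<^bsub>sp_group W\<^esub>"
    if "x \<in> carrier (sp_group W)" for x
    using that symplectic_inv(2) symplectic_matrix_inv by (auto simp: sp_group_simps)
qed (auto simp: sp_group_simps symplectic_mult symplectic_one matrix_mul_assoc)

lemma inv_sp_group: "inv\<^bsub>sp_group W\<^esub> A = matrix_inv A" if "symplectic A"
proof -
  interpret group "sp_group W" by (rule group_sp_group)
  show ?thesis
    using that symplectic_matrix_inv[OF that]
    by (intro inv_equality) (auto simp: sp_group_simps symplectic_inv[OF that])
qed

text \<open>Both I and -I are central.\<close>

lemma normal_plus_minus_one: "normal plus_minus_one (sp_group W)"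
proof -
  interpret group "sp_group W" by (rule group_sp_group)
  have "subgroup plus_minus_one (sp_group W)"
    by (rule subgroupI)
      (auto simp: plus_minus_one_def sp_group_simps symplectic_one symplectic_uminus
        inv_sp_group matrix_minus intro!: matrix_inv_unique)
  then show ?thesis
    unfolding normal_inv_iff
    by (auto simp: plus_minus_one_def sp_group_simps matrix_minus inv_sp_group symplectic_inv)
qed

text \<open>\<open>pr\<close> is a homomorphism with kernel {I, -I}, and the exponent is the order
  of the image.\<close>

lemma pow_ord_pr:
  assumes "symplectic A"
  shows "up_to_sign (A [^]\<^bsub>sp_group W\<^esub> group.ord (proj_group W) (pr W A)) (mat 1)"
proof -
  interpret normal plus_minus_one "sp_group W" by (rule normal_plus_minus_one)
  interpret Q: group "proj_group W"
    unfolding proj_group_def by (rule factorgroup_is_group)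
  interpret h: group_hom "sp_group W" "proj_group W" "pr W"
    unfolding group_hom_def group_hom_axioms_def
    using r_coset_hom_Mod is_group Q.is_group
    by (auto simp: proj_group_def pr_def[abs_def])
  have A: "A \<in> carrier (sp_group W)" using assms by (simp add: carrier_sp_group)
  let ?B = "A [^]\<^bsub>sp_group W\<^esub> Q.ord (pr W A)"
  have "pr W ?B = \<one>\<^bsub>proj_group W\<^esub>"
    using A by (simp add: h.hom_nat_pow)
  also have "\<dots> = plus_minus_one"
    by (simp add: proj_group_def)
  finally have "pr W ?B = plus_minus_one" .
  moreover have "?B \<in> pr W ?B"
    by (auto simp: pr_def r_coset_def plus_minus_one_def mult_sp_group)
  ultimately show ?thesis
    by (auto simp: plus_minus_one_def up_to_sign_def)
qed

end

locale reduction_group = symplectic_form W for W :: "real^'m::finite^'m" +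
  fixes G0 :: "(complex^'m^'m) set"
    and N :: nat
    and m :: "nat \<Rightarrow> nat"
    and \<Omega> :: "nat \<Rightarrow> complex^'m^'m"
    and \<omega> :: "complex^'m^'m \<Rightarrow> complex"
  assumes G0: "subgroup G0 (sp_group W)"
    and conj_inverse: "A \<in> G0 \<Longrightarrow> map_matrix cnj A ** A = mat 1 \<or> map_matrix cnj A ** A = - mat 1"
    and \<Omega>_in: "i \<in> {1..N} \<Longrightarrow> \<Omega> i \<in> G0"
    and m_eq: "i \<in> {1..N} \<Longrightarrow> m i = group.ord (proj_group W) (pr W (\<Omega> i))"
    and \<omega>_hom: "\<omega> \<in> hom (sp_group W\<lparr>carrier := G0\<rparr>) circle_group"
    and \<omega>_sign: "A \<in> G0 \<Longrightarrow> A \<in> plus_minus_one \<Longrightarrow> \<omega> A = 1"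
begin

section \<open>The group \<open>G0\<close> and its character\<close>

lemma G0_symplectic: "A \<in> G0 \<Longrightarrow> symplectic A"
  using subgroup.subset[OF G0] by (auto simp: carrier_sp_group)

lemma G0_mult: "A \<in> G0 \<Longrightarrow> B \<in> G0 \<Longrightarrow> A ** B \<in> G0"
  using subgroup.m_closed[OF G0] by (simp add: mult_sp_group)

lemma G0_one: "mat 1 \<in> G0"
  using subgroup.one_closed[OF G0] by (simp add: one_sp_group)

lemma G0_inv: "A \<in> G0 \<Longrightarrow> matrix_inv A \<in> G0"
  using subgroup.m_inv_closed[OF G0] by (metis G0_symplectic inv_sp_group)

text \<open>On \<open>G0\<close> complex conjugation is inversion up to sign. It preserves the order
  of products while inversion reverses it, so the two orders agree up to sign.\<close>

lemma G0_commute_up_to_sign: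
  assumes A: "A \<in> G0" and B: "B \<in> G0"
  shows "up_to_sign (A ** B) (B ** A)"
proof -
  define cj :: "complex^'m^'m \<Rightarrow> complex^'m^'m" where "cj = map_matrix cnj"
  have cj_mult: "cj (C ** D) = cj C ** cj D" for C D
    by (simp add: cj_def vec_eq_iff matrix_matrix_mult_def)
  have left: "up_to_sign (cj C ** C) (mat 1)" if "C \<in> G0" for C
    using conj_inverse[OF that] by (simp add: cj_def up_to_sign_def)
  have right: "up_to_sign (C ** cj C) (mat 1)" if "C \<in> G0" for C
  proof -
    have "cj (cj C ** C) = C ** cj C" "cj (mat 1) = mat 1" "cj (- mat 1) = - mat 1"
      unfolding cj_mult by (simp_all add: cj_def vec_eq_iff mat_def matrix_matrix_mult_def)
    then show ?thesis using left[OF that] by (metis up_to_sign_def)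
  qed
  have "up_to_sign (A ** B) ((B ** cj B) ** (A ** B))"
    using up_to_sign_mult[OF right[OF B] up_to_sign_refl, of "A ** B"] by (simp add: up_to_sign_sym)
  \<comment> \<open>Placing \<open>A ** cj A\<close> between \<open>B\<close> and
    \<open>cj B\<close> makes the conjugate of the whole product \<open>A ** B\<close>
    appear.\<close>
  also have "up_to_sign \<dots> ((B ** (A ** cj A) ** cj B) ** (A ** B))"
    using up_to_sign_mult[OF up_to_sign_refl[of B] right[OF A]]
    by (intro up_to_sign_mult up_to_sign_refl) (simp add: up_to_sign_sym)
  also have "\<dots> = (B ** A) ** (cj (A ** B) ** (A ** B))"
    by (simp add: cj_mult matrix_mul_assoc)
  also have "up_to_sign \<dots> (B ** A)"
    using up_to_sign_mult[OF up_to_sign_refl left[OF G0_mult[OF A B]], of "B ** A"] by simp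
  finally show ?thesis .
qed

lemma \<omega>_mult: "A \<in> G0 \<Longrightarrow> B \<in> G0 \<Longrightarrow> \<omega> (A ** B) = \<omega> A * \<omega> B"
  using hom_mult[OF \<omega>_hom] by (simp add: circle_group_def mult_sp_group)

lemma \<omega>_nonzero: "A \<in> G0 \<Longrightarrow> \<omega> A \<noteq> 0"
  using hom_in_carrier[OF \<omega>_hom] by (force simp: circle_group_def)

lemma \<omega>_one: "\<omega> (mat 1) = 1"
  by (rule \<omega>_sign) (simp_all add: G0_one plus_minus_one_def)

text \<open>The quotient A B^-1 lies in \<open>G0\<close> and is I or -I, so \<omega> sends it to
  1.\<close>

lemma \<omega>_up_to_sign:
  assumes "A \<in> G0" "B \<in> G0" "up_to_sign A B"
  shows "\<omega> A = \<omega> B"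
proof -
  let ?C = "A ** matrix_inv B"
  have "up_to_sign ?C (B ** matrix_inv B)"
    using assms(3) by (rule up_to_sign_mult) (rule up_to_sign_refl)
  then have "?C \<in> plus_minus_one"
    using symplectic_inv[OF G0_symplectic[OF assms(2)]]
    by (auto simp: up_to_sign_def plus_minus_one_def)
  moreover have C: "?C \<in> G0" using assms by (intro G0_mult G0_inv)
  moreover have "?C ** B = A"
    using symplectic_inv[OF G0_symplectic[OF assms(2)]] by (simp flip: matrix_mul_assoc)
  ultimately show ?thesis
    using \<omega>_mult[OF C assms(2)] \<omega>_sign[OF C] by simp
qed

section \<open>Powers of the generators and their ordered products\<close>

abbreviation pw :: "nat \<Rightarrow> nat \<Rightarrow> complex^'m^'m" where
  "pw i k \<equiv> \<Omega> i [^]\<^bsub>sp_group W\<^esub> k"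

lemma pw_in:
  assumes "i \<in> {1..N}"
  shows "pw i k \<in> G0"
  by (induction k) (simp_all add: one_sp_group mult_sp_group G0_one G0_mult \<Omega>_in[OF assms])

lemma pw_add:
  assumes "i \<in> {1..N}"
  shows "pw i (j + k) = pw i j ** pw i k"
  using monoid.nat_pow_mult[OF group.is_monoid[OF group_sp_group], of "\<Omega> i" j k]
    G0_symplectic[OF \<Omega>_in[OF assms]] by (simp add: mult_sp_group carrier_sp_group)

text \<open>Each full period contributes the power \<open>m i\<close>, which is I or -I; the
  induction counts the periods.\<close>

lemma pw_mod:
  assumes "i \<in> {1..N}"
  shows "up_to_sign (pw i (k mod m i)) (pw i k)"
proof -
  have "up_to_sign (pw i (m i * q)) (mat 1)" for q
  proof (induction q)
    case 0
    then show ?case by (simp add: one_sp_group up_to_sign_refl)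
  next
    case (Suc q)
    have "up_to_sign (pw i (m i)) (mat 1)"
      using pow_ord_pr[OF G0_symplectic[OF \<Omega>_in[OF assms]]] m_eq[OF assms] by simp
    from up_to_sign_mult[OF this Suc] show ?case
      by (simp add: pw_add[OF assms])
  qed
  from up_to_sign_mult[OF up_to_sign_refl this, of "pw i (k mod m i)" "k div m i"]
  have "up_to_sign (pw i (k mod m i + m i * (k div m i))) (pw i (k mod m i))"
    unfolding pw_add[OF assms] by simp
  then show ?thesis by (simp add: up_to_sign_sym)
qed

lemma \<omega>_pw:
  assumes "i \<in> {1..N}"
  shows "\<omega> (pw i k) = \<omega> (\<Omega> i) ^ k"
  by (induction k)
    (simp_all add: one_sp_group mult_sp_group \<omega>_one \<omega>_mult pw_in[OF assms] \<Omega>_in[OF assms])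

lemma foldr_mult_in:
  assumes "\<And>i. i \<in> set xs \<Longrightarrow> f i \<in> G0"
  shows "foldr (\<lambda>i B. f i ** B) xs (mat 1) \<in> G0"
  using assms by (induction xs) (simp_all add: G0_one G0_mult)

text \<open>To separate the interleaved factors, each \<open>h i\<close> has to pass the product of
  all later \<open>g\<close> factors; commuting inside \<open>G0\<close> costs at most a
  sign.\<close>

lemma foldr_mult_up_to_sign:
  assumes "\<And>i. i \<in> set xs \<Longrightarrow> g i \<in> G0" "\<And>i. i \<in> set xs \<Longrightarrow> h i \<in> G0"
    and "\<And>i. i \<in> set xs \<Longrightarrow> up_to_sign (f i) (g i ** h i)"
  shows "up_to_sign (foldr (\<lambda>i B. f i ** B) xs (mat 1))
    (foldr (\<lambda>i B. g i ** B) xs (mat 1) ** foldr (\<lambda>i B. h i ** B) xs (mat 1))"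
  using assms
proof (induction xs)
  case Nil
  then show ?case by (simp add: up_to_sign_refl)
next
  case (Cons i xs)
  let ?G = "foldr (\<lambda>i B. g i ** B) xs (mat 1)" and ?H = "foldr (\<lambda>i B. h i ** B) xs (mat 1)"
  have G: "?G \<in> G0" using Cons.prems by (intro foldr_mult_in) simp
  have IH: "up_to_sign (foldr (\<lambda>i B. f i ** B) xs (mat 1)) (?G ** ?H)"
    using Cons.prems by (intro Cons.IH) simp_all
  have "up_to_sign (foldr (\<lambda>i B. f i ** B) (i # xs) (mat 1)) ((g i ** h i) ** (?G ** ?H))"
    using up_to_sign_mult[OF _ IH, of "f i" "g i ** h i"] Cons.prems(3) by simp
  also have "(g i ** h i) ** (?G ** ?H) = g i ** (h i ** ?G) ** ?H"
    by (simp add: matrix_mul_assoc)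
  also have "up_to_sign \<dots> (g i ** (?G ** h i) ** ?H)"
    using Cons.prems(2)[of i] G
    by (intro up_to_sign_mult up_to_sign_refl G0_commute_up_to_sign) simp_all
  finally show ?case by (simp add: matrix_mul_assoc)
qed

section \<open>Arithmetic of multi-indices modulo the orders\<close>

abbreviation S :: "(nat \<Rightarrow> nat) set" where "S \<equiv> multi_indices N m"
abbreviation P :: "(nat \<Rightarrow> nat) \<Rightarrow> complex^'m^'m" where "P \<equiv> mat_pow W N \<Omega>"
abbreviation \<theta> :: "(nat \<Rightarrow> nat) \<Rightarrow> complex" where "\<theta> \<equiv> char_pow N \<Omega> \<omega>"

text \<open>Addition in the product of the cyclic groups Z/m_i. The restricted lambda keeps the
  result extensional, as \<open>multi_indices\<close> requires.\<close>

definition index_add :: "(nat \<Rightarrow> nat) \<Rightarrow> (nat \<Rightarrow> nat) \<Rightarrow> nat \<Rightarrow> nat" where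
  "index_add \<alpha> \<beta> = (\<lambda>i\<in>{1..N}. (\<alpha> i + \<beta> i) mod m i)"

text \<open>The outer \<open>mod\<close> sends the value \<open>m i\<close>, which arises when
  \<open>\<alpha> i = 0\<close>, back to 0. On \<open>S\<close> the natural-number subtraction never
  truncates.\<close>

definition index_neg :: "(nat \<Rightarrow> nat) \<Rightarrow> nat \<Rightarrow> nat" where
  "index_neg \<alpha> = (\<lambda>i\<in>{1..N}. (m i - \<alpha> i) mod m i)"

lemma index_add_commute: "index_add \<alpha> \<beta> = index_add \<beta> \<alpha>"
  by (simp add: index_add_def add.commute)

lemma multi_indices_less: "\<alpha> \<in> S \<Longrightarrow> i \<in> {1..N} \<Longrightarrow> \<alpha> i < m i"
  by (auto simp: multi_indices_def PiE_def Pi_def)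

lemma multi_indices_eqI:
  "\<alpha> \<in> S \<Longrightarrow> \<beta> \<in> S \<Longrightarrow> (\<And>i. i \<in> {1..N} \<Longrightarrow> \<alpha> i = \<beta> i) \<Longrightarrow> \<alpha> = \<beta>"
  unfolding multi_indices_def by (rule PiE_ext)

lemma index_add_in: "\<alpha> \<in> S \<Longrightarrow> index_add \<alpha> \<beta> \<in> S"
  using multi_indices_less by (force simp: index_add_def multi_indices_def)

lemma index_neg_in: "\<alpha> \<in> S \<Longrightarrow> index_neg \<alpha> \<in> S"
  using multi_indices_less by (force simp: index_neg_def multi_indices_def)

lemma index_add_neg_cancel:
  assumes "\<alpha> \<in> S" "\<beta> \<in> S"
  shows "index_add (index_neg \<beta>) (index_add \<beta> \<alpha>) = \<alpha>"
    and "index_add \<beta> (index_add (index_neg \<beta>) \<alpha>) = \<alpha>"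
proof -
  have *: "((m i - \<beta> i) mod m i + (\<beta> i + \<alpha> i) mod m i) mod m i = \<alpha> i"
    "(\<beta> i + ((m i - \<beta> i) mod m i + \<alpha> i) mod m i) mod m i = \<alpha> i"
    if "i \<in> {1..N}" for i
    using multi_indices_less[OF assms(1) that] multi_indices_less[OF assms(2) that]
    by (simp_all add: mod_simps)
  show "index_add (index_neg \<beta>) (index_add \<beta> \<alpha>) = \<alpha>"
    by (intro multi_indices_eqI index_add_in index_neg_in assms)
      (use * in \<open>simp add: index_add_def index_neg_def\<close>)
  show "index_add \<beta> (index_add (index_neg \<beta>) \<alpha>) = \<alpha>"
    by (intro multi_indices_eqI index_add_in index_neg_in assms)
      (use * in \<open>simp add: index_add_def index_neg_def\<close>)
qed

lemma index_neg_neg: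
  assumes "\<alpha> \<in> S"
  shows "index_neg (index_neg \<alpha>) = \<alpha>"
proof (intro multi_indices_eqI index_neg_in assms)
  fix i assume i: "i \<in> {1..N}"
  show "index_neg (index_neg \<alpha>) i = \<alpha> i"
    using multi_indices_less[OF assms i] i by (cases "\<alpha> i = 0") (simp_all add: index_neg_def)
qed

text \<open>Translation by \<beta> permutes \<open>S\<close>, with translation by the negative as
  inverse. This is the change of summation variable used for the bracket.\<close>

lemma sum_index_add: "\<beta> \<in> S \<Longrightarrow> (\<Sum>\<alpha>\<in>S. f \<alpha>) = (\<Sum>\<alpha>\<in>S. f (index_add \<beta> \<alpha>))"
  by (rule sum.reindex_bij_witness[of _ "index_add \<beta>" "index_add (index_neg \<beta>)"])
    (simp_all add: index_add_neg_cancel index_add_in index_neg_in)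

lemma sum_index_neg: "(\<Sum>\<alpha>\<in>S. f \<alpha>) = (\<Sum>\<alpha>\<in>S. f (index_neg \<alpha>))"
  by (rule sum.reindex_bij_witness[of _ index_neg index_neg])
    (simp_all add: index_neg_neg index_neg_in)

lemma mat_pow_in: "P \<alpha> \<in> G0"
  unfolding mat_pow_def by (rule foldr_mult_in) (auto intro!: pw_in)

text \<open>The sign absorbs both the reordering of the generators and the reduction of the
  exponents modulo \<open>m\<close>.\<close>

lemma mat_pow_index_add: "up_to_sign (P (index_add \<alpha> \<beta>)) (P \<alpha> ** P \<beta>)"
  unfolding mat_pow_def
proof (rule foldr_mult_up_to_sign)
  fix i assume "i \<in> set [1..<Suc N]"
  then have i: "i \<in> {1..N}" by auto
  show "pw i (\<alpha> i) \<in> G0" "pw i (\<beta> i) \<in> G0" using pw_in[OF i] by auto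
  show "up_to_sign (pw i (index_add \<alpha> \<beta> i)) (pw i (\<alpha> i) ** pw i (\<beta> i))"
    using pw_mod[OF i, of "\<alpha> i + \<beta> i"] i by (simp add: index_add_def pw_add[OF i])
qed

lemma \<omega>_mat_pow: "\<omega> (P \<alpha>) = \<theta> \<alpha>"
proof -
  \<comment> \<open>The list is generalised for the induction; since \<open>[1..<Suc N]\<close> is
    distinct, its list product is the product over the set.\<close>
  have "\<omega> (foldr (\<lambda>i B. pw i (\<alpha> i) ** B) xs (mat 1)) = prod_list (map (\<lambda>i. \<omega> (\<Omega> i) ^ \<alpha> i) xs)"
    if "set xs \<subseteq> {1..N}" for xs
    using that
    by (induction xs)
      (simp_all add: \<omega>_one \<omega>_mult \<omega>_pw pw_in subset_iff foldr_mult_in)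
  from this[of "[1..<Suc N]"] show ?thesis
    unfolding mat_pow_def char_pow_def
    by (simp add: atLeastLessThanSuc_atLeastAtMost del: upt_Suc flip: prod.distinct_set_conv_list)
qed

lemma char_pow_nonzero: "\<theta> \<alpha> \<noteq> 0"
  using \<omega>_nonzero[OF mat_pow_in] by (simp add: \<omega>_mat_pow)

text \<open>Exact, unlike the rule for \<open>P\<close>, because \<omega> does not see
  signs.\<close>

lemma char_pow_index_add: "\<theta> (index_add \<alpha> \<beta>) = \<theta> \<alpha> * \<theta> \<beta>"
  using \<omega>_up_to_sign[OF mat_pow_in G0_mult[OF mat_pow_in mat_pow_in] mat_pow_index_add]
  by (simp add: \<omega>_mult mat_pow_in \<omega>_mat_pow)

text \<open>The indices add up to zero in every component, and a product of zeroth powers is I; the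
  sign is that of \<open>mat_pow_index_add\<close>.\<close>

lemma mat_pow_add_neg: "\<alpha> \<in> S \<Longrightarrow> up_to_sign (P \<alpha> ** P (index_neg \<alpha>)) (mat 1)"
proof -
  assume "\<alpha> \<in> S"
  then have 0: "index_add \<alpha> (index_neg \<alpha>) i = 0" if "i \<in> {1..N}" for i
    using multi_indices_less[of \<alpha> i] that by (simp add: index_add_def index_neg_def mod_simps)
  have "foldr (\<lambda>i B. pw i (index_add \<alpha> (index_neg \<alpha>) i) ** B) xs (mat 1) = mat 1"
    if "set xs \<subseteq> {1..N}" for xs
    using that by (induction xs) (simp_all add: 0 one_sp_group del: atLeastAtMost_iff)
  from this[of "[1..<Suc N]"] have "P (index_add \<alpha> (index_neg \<alpha>)) = mat 1"
    by (simp add: mat_pow_def atLeastLessThanSuc_atLeastAtMost del: upt_Suc)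
  then show ?thesis using mat_pow_index_add[of \<alpha> "index_neg \<alpha>"] by (simp add: up_to_sign_sym)
qed

lemma char_pow_index_neg: "\<alpha> \<in> S \<Longrightarrow> \<theta> (index_neg \<alpha>) = 1 / \<theta> \<alpha>"
  using \<omega>_up_to_sign[OF G0_mult[OF mat_pow_in mat_pow_in] G0_one mat_pow_add_neg]
  by (simp add: \<omega>_mult mat_pow_in \<omega>_mat_pow \<omega>_one field_simps char_pow_nonzero)

lemma mat_pow_index_neg: "\<alpha> \<in> S \<Longrightarrow> up_to_sign (P (index_neg \<alpha>)) (matrix_inv (P \<alpha>))"
  using up_to_sign_mult[OF up_to_sign_refl mat_pow_add_neg, of \<alpha> "matrix_inv (P \<alpha>)"]
  by (simp add: matrix_mul_assoc symplectic_inv[OF G0_symplectic[OF mat_pow_in]])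

end

subsection \<open>The Lax matrix\<close>

lemma tensor_comm_left_add:
  "tensor_comm A (tensor_mat (X + Y) (mat 1)) a b c d =
     tensor_comm A (tensor_mat X (mat 1)) a b c d + tensor_comm A (tensor_mat Y (mat 1)) a b c d"
  by (simp add: tensor_comm_mat_left algebra_simps flip: sum.distrib)

lemma tensor_comm_right_add:
  "tensor_comm A (tensor_mat (mat 1) (X + Y)) a b c d =
     tensor_comm A (tensor_mat (mat 1) X) a b c d + tensor_comm A (tensor_mat (mat 1) Y) a b c d"
  by (simp add: tensor_comm_mat_right algebra_simps flip: sum.distrib)

lemma tensor_comm_left_scale:
  "tensor_comm A (tensor_mat (scale_mat s X) (mat 1)) a b c d =
     s * tensor_comm A (tensor_mat X (mat 1)) a b c d"
  by (simp add: tensor_comm_mat_left algebra_simps sum_distrib_left)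

lemma tensor_comm_right_scale:
  "tensor_comm A (tensor_mat (mat 1) (scale_mat s X)) a b c d =
     s * tensor_comm A (tensor_mat (mat 1) X) a b c d"
  by (simp add: tensor_comm_mat_right algebra_simps sum_distrib_left)

lemma tensor_comm_left_sum:
  "tensor_comm A (tensor_mat (\<Sum>i\<in>I. X i) (mat 1)) a b c d =
     (\<Sum>i\<in>I. tensor_comm A (tensor_mat (X i) (mat 1)) a b c d)"
  by (rule Modules.additive.sum, rule Modules.additive.intro) (simp add: tensor_comm_left_add)

lemma tensor_comm_right_sum:
  "tensor_comm A (tensor_mat (mat 1) (\<Sum>i\<in>I. X i)) a b c d =
     (\<Sum>i\<in>I. tensor_comm A (tensor_mat (mat 1) (X i)) a b c d)"
  by (rule Modules.additive.sum, rule Modules.additive.intro) (simp add: tensor_comm_right_add)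

text \<open>By \<open>lax_term_entry\<close> the entry is a product of two functions that are affine
  in t.\<close>

lemma lax_term_has_derivative:
  "((\<lambda>t. lax_term W P (v + t *\<^sub>R axis j 1) $ a $ b) has_vector_derivative
     lax_term_deriv W P v j a b) (at 0)" if "symplectic_form W"
proof -
  interpret symplectic_form W by fact
  let ?x = "\<lambda>v::real^'a. \<chi> i. complex_of_real (v $ i)"
  have lin: "(A *v ?x (v + t *\<^sub>R axis j 1)) $ i = (A *v ?x v) $ i + t *\<^sub>R A $ i $ j"
    for A :: "complex^'a^'b" and i t
  proof -
    have "(A *v ?x (v + t *\<^sub>R axis j 1)) $ i
        = (\<Sum>k\<in>UNIV. A $ i $ k * of_real (v $ k) + (if k = j then of_real t * A $ i $ k else 0))"
      unfolding matrix_vector_mult_def by (auto simp: axis_def algebra_simps intro!: sum.cong)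
    then show ?thesis
      by (simp add: sum.distrib matrix_vector_mult_def scaleR_conv_of_real)
  qed
  show ?thesis
    unfolding lax_term_entry lin lax_term_deriv_def
    by (auto intro!: derivative_eq_intros)
qed

lemma lax_eq:
  "lax W N m \<Omega> \<omega> \<kappa> K l z \<Phi> = K + scale_mat (of_real \<kappa>)
     (\<Sum>\<alpha>\<in>multi_indices N m. \<Sum>\<sigma>\<in>UNIV.
        scale_mat (1 / (z - char_pow N \<Omega> \<omega> \<alpha> * of_real (l \<sigma>)))
          (lax_term W (mat_pow W N \<Omega> \<alpha>) (column \<sigma> \<Phi>)))"
  by (simp add: lax_def lax_term_def column_def)

text \<open>Only the column \<sigma> moves, so the sum over columns collapses to one term. At a pole
  the coefficient is \<open>1 / 0 = 0\<close> on both sides.\<close>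

lemma partial_deriv_lax:
  assumes "symplectic_form W"
  shows "partial_deriv j \<sigma> (\<lambda>\<Phi>. lax W N m \<Omega> \<omega> \<kappa> K l z \<Phi> $ a $ b) \<Phi> =
    of_real \<kappa> * (\<Sum>\<alpha>\<in>multi_indices N m. 1 / (z - char_pow N \<Omega> \<omega> \<alpha> * of_real (l \<sigma>)) *
      lax_term_deriv W (mat_pow W N \<Omega> \<alpha>) (column \<sigma> \<Phi>) j a b)"
proof -
  let ?u = "\<lambda>\<alpha> \<tau>. 1 / (z - char_pow N \<Omega> \<omega> \<alpha> * of_real (l \<tau>))"
  let ?P = "mat_pow W N \<Omega>"
  have column_shift: "column \<tau> (\<Phi> + t *\<^sub>R axis j (axis \<sigma> 1)) =
      (if \<tau> = \<sigma> then column \<tau> \<Phi> + t *\<^sub>R axis j 1 else column \<tau> \<Phi>)" for \<tau> t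
    by (auto simp: vec_eq_iff column_def axis_def)
  have summand: "((\<lambda>t. lax_term W (?P \<alpha>) (column \<tau> (\<Phi> + t *\<^sub>R axis j (axis \<sigma> 1))) $ a $ b)
      has_vector_derivative
        (if \<tau> = \<sigma> then lax_term_deriv W (?P \<alpha>) (column \<tau> \<Phi>) j a b else 0)) (at 0)" for \<alpha> \<tau>
    using lax_term_has_derivative[OF assms] by (simp add: column_shift)
  have "((\<lambda>t. lax W N m \<Omega> \<omega> \<kappa> K l z (\<Phi> + t *\<^sub>R axis j (axis \<sigma> 1)) $ a $ b)
      has_vector_derivative (0 + of_real \<kappa> * (\<Sum>\<alpha>\<in>multi_indices N m. \<Sum>\<tau>\<in>UNIV. ?u \<alpha> \<tau> *
        (if \<tau> = \<sigma> then lax_term_deriv W (?P \<alpha>) (column \<tau> \<Phi>) j a b else 0)))) (at 0)"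
    unfolding lax_eq vector_add_component nth_map_matrix sum_component
    by (intro has_vector_derivative_add has_vector_derivative_const
        has_vector_derivative_mult_right has_vector_derivative_sum summand)
  then show ?thesis
    unfolding partial_deriv_def
    by (subst vector_derivative_at, assumption) (simp add: if_distrib[of "\<lambda>x. _ * x"] cong: if_cong)
qed

text \<open>Partial fractions: with x = z - e s and y = w - c e s, the combination y - c x equals w
  - c z, in which s has cancelled.\<close>

lemma bracket_coefficient_split:
  fixes z w c s :: complex
  assumes "z \<noteq> e * s" "w \<noteq> c * e * s" "w \<noteq> c * z"
  shows "1 / (z - e * s) * (1 / (w - c * e * s)) =
    1 / (w - c * z) * (1 / (z - e * s) - c / (w - c * e * s))"
  using assms by (simp add: divide_simps) (simp add: algebra_simps)

text \<open>Membership in \<open>D1\<close> gives R X = K R for X = K / \<omega>(R), so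
  \<open>r_core_intertwines\<close> applies. The factor \<omega>(R) matches the ratio of the
  coefficients in \<open>r2\<close> and \<open>r1\<close>.\<close>

lemma (in symplectic_form) D1_tensor_comm:
  assumes "K \<in> D1 W G0 \<omega>" "R \<in> G0" "symplectic R" "\<omega> R \<noteq> 0"
  shows "\<omega> R * tensor_comm (r_core W R) (tensor_mat (mat 1) K) a b c d =
    - tensor_comm (r_core W R) (tensor_mat K (mat 1)) a b c d"
proof -
  have "K \<in> sp_algebra W" and K: "R ** K ** matrix_inv R = scale_mat (\<omega> R) K"
    using assms by (auto simp: D1_def)
  have "R ** K = R ** K ** (matrix_inv R ** R)"
    by (simp add: symplectic_inv[OF assms(3)])
  also have "\<dots> = scale_mat (\<omega> R) (K ** R)"
    unfolding matrix_mul_assoc K by (rule scale_mat_mult_left)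
  finally have RK: "R ** K = scale_mat (\<omega> R) (K ** R)" .
  have "R ** scale_mat (inverse (\<omega> R)) K = scale_mat (inverse (\<omega> R)) (R ** K)"
    by (rule scale_mat_mult_right)
  then have "R ** scale_mat (inverse (\<omega> R)) K = K ** R"
    unfolding RK using assms(4) by (simp add: vec_eq_iff)
  from r_core_intertwines[OF assms(3) \<open>K \<in> sp_algebra W\<close> this] show ?thesis
    using assms(4) by (simp add: tensor_comm_left_scale)
qed

section \<open>Rearrangement of finite sums\<close>

lemma sum_rotate:
  "(\<Sum>i\<in>A. \<Sum>j\<in>B. \<Sum>k\<in>C. f i j k) = (\<Sum>k\<in>C. \<Sum>i\<in>A. \<Sum>j\<in>B. f i j k)"
proof -
  have "(\<Sum>i\<in>A. \<Sum>j\<in>B. \<Sum>k\<in>C. f i j k) = (\<Sum>i\<in>A. \<Sum>k\<in>C. \<Sum>j\<in>B. f i j k)"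
    by (rule sum.cong[OF refl]) (rule sum.swap)
  also have "\<dots> = (\<Sum>k\<in>C. \<Sum>i\<in>A. \<Sum>j\<in>B. f i j k)"
    by (rule sum.swap)
  finally show ?thesis .
qed

text \<open>With \<open>J\<close> the Poisson tensor and the inner sums the derivatives of the Lax
  matrix, the coordinate sums end up innermost, which isolates the bracket of each pair of rank-one
  terms.\<close>

lemma sum_bilinear_regroup:
  fixes J :: "'j \<Rightarrow> 'k \<Rightarrow> 'a::comm_ring_1"
  shows "(\<Sum>j\<in>A. \<Sum>k\<in>B. \<Sum>s\<in>T.
        J j k * (x * (\<Sum>\<alpha>\<in>S. p \<alpha> s * f \<alpha> s j)) * (x * (\<Sum>\<beta>\<in>S'. q \<beta> s * g \<beta> s k)))
    = (\<Sum>\<alpha>\<in>S. \<Sum>\<beta>\<in>S'. \<Sum>s\<in>T.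
        x\<^sup>2 * (p \<alpha> s * q \<beta> s) * (\<Sum>j\<in>A. \<Sum>k\<in>B. J j k * f \<alpha> s j * g \<beta> s k))"
proof -
  define F where "F j k s \<alpha> \<beta> = x\<^sup>2 * (p \<alpha> s * q \<beta> s) * (J j k * f \<alpha> s j * g \<beta> s k)" for j k s \<alpha> \<beta>
  have "J j k * (x * (\<Sum>\<alpha>\<in>S. p \<alpha> s * f \<alpha> s j)) * (x * (\<Sum>\<beta>\<in>S'. q \<beta> s * g \<beta> s k)) =
      (\<Sum>\<alpha>\<in>S. \<Sum>\<beta>\<in>S'. F j k s \<alpha> \<beta>)" for j k s
  proof -
    have "J j k * (x * a) * (x * b) = x\<^sup>2 * J j k * (a * b)" for a b
      by (simp add: power2_eq_square algebra_simps)
    then show ?thesis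
      by (simp only: sum_product) (simp add: sum_distrib_left F_def mult_ac)
  qed
  then have "(\<Sum>j\<in>A. \<Sum>k\<in>B. \<Sum>s\<in>T.
        J j k * (x * (\<Sum>\<alpha>\<in>S. p \<alpha> s * f \<alpha> s j)) * (x * (\<Sum>\<beta>\<in>S'. q \<beta> s * g \<beta> s k)))
    = (\<Sum>j\<in>A. \<Sum>k\<in>B. \<Sum>s\<in>T. \<Sum>\<alpha>\<in>S. \<Sum>\<beta>\<in>S'. F j k s \<alpha> \<beta>)"
    by simp
  also have "\<dots> = (\<Sum>s\<in>T. \<Sum>j\<in>A. \<Sum>k\<in>B. \<Sum>\<alpha>\<in>S. \<Sum>\<beta>\<in>S'. F j k s \<alpha> \<beta>)"
    by (rule sum_rotate)
  also have "\<dots> = (\<Sum>s\<in>T. \<Sum>\<alpha>\<in>S. \<Sum>\<beta>\<in>S'. \<Sum>j\<in>A. \<Sum>k\<in>B. F j k s \<alpha> \<beta>)"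
    by (simp only: sum_rotate[of _ S B A] sum_rotate[of _ S' B A])
  also have "\<dots> = (\<Sum>\<alpha>\<in>S. \<Sum>\<beta>\<in>S'. \<Sum>s\<in>T. \<Sum>j\<in>A. \<Sum>k\<in>B. F j k s \<alpha> \<beta>)"
    by (rule sum_rotate[symmetric])
  finally show ?thesis
    by (simp add: F_def sum_distrib_left)
qed

subsection \<open>The Poisson bracket\<close>

context reduction_group
begin

lemma mat_pow_symplectic: "symplectic (P \<alpha>)"
  by (rule G0_symplectic[OF mat_pow_in])

lemma r_core_up_to_sign: "up_to_sign A B \<Longrightarrow> symplectic B \<Longrightarrow> r_core W A = r_core W B"
  by (auto simp: up_to_sign_def r_core_uminus)

lemma lax_term_up_to_sign: "up_to_sign A B \<Longrightarrow> lax_term W A = lax_term W B"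
  by (auto simp: up_to_sign_def fun_eq_iff lax_term_uminus)

lemma lax_term_deriv_up_to_sign: "up_to_sign A B \<Longrightarrow> lax_term_deriv W A = lax_term_deriv W B"
  by (auto simp: up_to_sign_def fun_eq_iff lax_term_deriv_uminus)

lemma r1_eq: "r1 W N m \<Omega> \<omega> \<kappa> z w =
    (\<lambda>a b c d. \<Sum>\<gamma>\<in>S. of_real \<kappa> / (w - \<theta> \<gamma> * z) * r_core W (P \<gamma>) a b c d)"
  by (intro ext) (simp add: r1_def r_core_def Let_def)

lemma r2_eq: "r2 W N m \<Omega> \<omega> \<kappa> z w =
    (\<lambda>a b c d. \<Sum>\<gamma>\<in>S. of_real \<kappa> * \<theta> \<gamma> / (w - \<theta> \<gamma> * z) * r_core W (P \<gamma>) a b c d)"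
  by (intro ext) (simp add: r2_def r_core_def Let_def)

text \<open>Substitute -\<gamma> for \<gamma>: this inverts \<open>P \<gamma>\<close> up to sign,
  undone by \<open>r_core_swap\<close>, and inverts \<open>\<theta> \<gamma>\<close>, which turns
  the coefficient into minus that of \<open>r2\<close>. Where a denominator vanishes, the
  coefficients on both sides are 0.\<close>

lemma r2_eq_minus_r1:
  "r2 W N m \<Omega> \<omega> \<kappa> z w a b c d = - r1 W N m \<Omega> \<omega> \<kappa> w z c d a b"
proof -
  have "r1 W N m \<Omega> \<omega> \<kappa> w z c d a b =
      (\<Sum>\<gamma>\<in>S. of_real \<kappa> / (z - \<theta> (index_neg \<gamma>) * w) * r_core W (P (index_neg \<gamma>)) c d a b)"
    unfolding r1_eq by (rule sum_index_neg)
  also have "\<dots> = (\<Sum>\<gamma>\<in>S. - (of_real \<kappa> * \<theta> \<gamma> / (w - \<theta> \<gamma> * z) * r_core W (P \<gamma>) a b c d))"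
  proof (rule sum.cong[OF refl])
    fix \<gamma> assume \<gamma>: "\<gamma> \<in> S"
    have "r_core W (P (index_neg \<gamma>)) c d a b = r_core W (P \<gamma>) a b c d"
      using r_core_up_to_sign[OF mat_pow_index_neg[OF \<gamma>]] r_core_swap[OF mat_pow_symplectic]
        symplectic_matrix_inv[OF mat_pow_symplectic] by simp
    moreover have "of_real \<kappa> / (z - \<theta> (index_neg \<gamma>) * w) =
        - (of_real \<kappa> * \<theta> \<gamma> / (w - \<theta> \<gamma> * z))"
    proof -
      have "z - \<theta> (index_neg \<gamma>) * w = - ((w - \<theta> \<gamma> * z) / \<theta> \<gamma>)"
        using char_pow_nonzero[of \<gamma>] by (simp add: char_pow_index_neg[OF \<gamma>] field_simps)
      then show ?thesis by simp
    qed
    ultimately show "of_real \<kappa> / (z - \<theta> (index_neg \<gamma>) * w) * r_core W (P (index_neg \<gamma>)) c d a b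
        = - (of_real \<kappa> * \<theta> \<gamma> / (w - \<theta> \<gamma> * z) * r_core W (P \<gamma>) a b c d)"
      by simp
  qed
  finally show ?thesis by (simp add: r2_eq sum_negf)
qed

text \<open>After expansion the bracket is indexed by the difference \<gamma> of the two
  multi-indices and compared with the right-hand side for each \<gamma> separately.\<close>

lemma lax_poisson_bracket:
  fixes l :: "'r::finite \<Rightarrow> real"
  assumes K: "K \<in> D1 W G0 \<omega>"
    and zw: "\<And>\<gamma>. \<gamma> \<in> S \<Longrightarrow> w \<noteq> \<theta> \<gamma> * z"
    and z: "\<And>\<alpha> \<sigma>. \<alpha> \<in> S \<Longrightarrow> z \<noteq> \<theta> \<alpha> * of_real (l \<sigma>)"
    and w: "\<And>\<alpha> \<sigma>. \<alpha> \<in> S \<Longrightarrow> w \<noteq> \<theta> \<alpha> * of_real (l \<sigma>)"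
  shows "poisson W (\<lambda>\<Phi>. lax W N m \<Omega> \<omega> \<kappa> K l z \<Phi> $ a $ b)
      (\<lambda>\<Phi>. lax W N m \<Omega> \<omega> \<kappa> K l w \<Phi> $ c $ d) \<Phi> =
    tensor_comm (r1 W N m \<Omega> \<omega> \<kappa> z w)
      (tensor_mat (lax W N m \<Omega> \<omega> \<kappa> K l z \<Phi>) (mat 1)) a b c d
    + tensor_comm (r2 W N m \<Omega> \<omega> \<kappa> z w)
      (tensor_mat (mat 1) (lax W N m \<Omega> \<omega> \<kappa> K l w \<Phi>)) a b c d"
proof -
  let ?u = "\<lambda>\<alpha> \<sigma>. 1 / (z - \<theta> \<alpha> * of_real (l \<sigma>))"
  let ?v = "\<lambda>\<alpha> \<sigma>. 1 / (w - \<theta> \<alpha> * of_real (l \<sigma>))"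
  let ?D = "\<lambda>\<gamma>. w - \<theta> \<gamma> * z"
  let ?k = "of_real \<kappa> :: complex"
  let ?left = "\<lambda>\<gamma> X. tensor_comm (r_core W (P \<gamma>)) (tensor_mat X (mat 1)) a b c d"
  let ?right = "\<lambda>\<gamma> X. tensor_comm (r_core W (P \<gamma>)) (tensor_mat (mat 1) X) a b c d"
  define U where "U \<alpha> \<sigma> = lax_term W (P \<alpha>) (column \<sigma> \<Phi>)" for \<alpha> \<sigma>
  define T where "T \<gamma> \<alpha> \<sigma> = ?left \<gamma> (U \<alpha> \<sigma>)" for \<gamma> \<alpha> \<sigma>

  have "poisson W (\<lambda>\<Phi>. lax W N m \<Omega> \<omega> \<kappa> K l z \<Phi> $ a $ b)
      (\<lambda>\<Phi>. lax W N m \<Omega> \<omega> \<kappa> K l w \<Phi> $ c $ d) \<Phi> =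
    (\<Sum>\<alpha>\<in>S. \<Sum>\<beta>\<in>S. \<Sum>\<sigma>\<in>UNIV. ?k\<^sup>2 * (?u \<alpha> \<sigma> * ?v \<beta> \<sigma>) *
      (\<Sum>j\<in>UNIV. \<Sum>k\<in>UNIV. of_real (matrix_inv W $ j $ k) *
        lax_term_deriv W (P \<alpha>) (column \<sigma> \<Phi>) j a b * lax_term_deriv W (P \<beta>) (column \<sigma> \<Phi>) k c d))"
    unfolding poisson_def partial_deriv_lax[OF symplectic_form_axioms]
    by (rule sum_bilinear_regroup)
  \<comment> \<open>For \<beta> = \<alpha> + \<gamma> the second matrix is
    \<open>P \<gamma> ** P \<alpha>\<close> up to sign, so the inner bracket is a left commutator
    with the core tensor of \<open>P \<gamma>\<close>.\<close>
  also have "\<dots> = (\<Sum>\<alpha>\<in>S. \<Sum>\<gamma>\<in>S. \<Sum>\<sigma>\<in>UNIV. ?k\<^sup>2 * (?u \<alpha> \<sigma> * ?v (index_add \<alpha> \<gamma>) \<sigma>) * T \<gamma> \<alpha> \<sigma>)"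
  proof (rule sum.cong[OF refl])
    fix \<alpha> assume \<alpha>: "\<alpha> \<in> S"
    have add_deriv: "lax_term_deriv W (P (index_add \<alpha> \<gamma>)) = lax_term_deriv W (P \<gamma> ** P \<alpha>)" for \<gamma>
      by (metis lax_term_deriv_up_to_sign mat_pow_index_add index_add_commute)
    show "(\<Sum>\<beta>\<in>S. \<Sum>\<sigma>\<in>UNIV. ?k\<^sup>2 * (?u \<alpha> \<sigma> * ?v \<beta> \<sigma>) *
      (\<Sum>j\<in>UNIV. \<Sum>k\<in>UNIV. of_real (matrix_inv W $ j $ k) *
        lax_term_deriv W (P \<alpha>) (column \<sigma> \<Phi>) j a b * lax_term_deriv W (P \<beta>) (column \<sigma> \<Phi>) k c d))
      = (\<Sum>\<gamma>\<in>S. \<Sum>\<sigma>\<in>UNIV. ?k\<^sup>2 * (?u \<alpha> \<sigma> * ?v (index_add \<alpha> \<gamma>) \<sigma>) * T \<gamma> \<alpha> \<sigma>)"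
      by (subst sum_index_add[OF \<alpha>])
        (simp only: add_deriv lax_term_deriv_bracket mat_pow_symplectic T_def U_def)
  qed
  also have "\<dots> = (\<Sum>\<gamma>\<in>S. \<Sum>\<alpha>\<in>S. \<Sum>\<sigma>\<in>UNIV. ?k\<^sup>2 * (?u \<alpha> \<sigma> * ?v (index_add \<alpha> \<gamma>) \<sigma>) * T \<gamma> \<alpha> \<sigma>)"
    by (rule sum.swap)
  finally have lhs: "poisson W (\<lambda>\<Phi>. lax W N m \<Omega> \<omega> \<kappa> K l z \<Phi> $ a $ b)
      (\<lambda>\<Phi>. lax W N m \<Omega> \<omega> \<kappa> K l w \<Phi> $ c $ d) \<Phi> = \<dots>" .

  have per_index: "(\<Sum>\<alpha>\<in>S. \<Sum>\<sigma>\<in>UNIV. ?k\<^sup>2 * (?u \<alpha> \<sigma> * ?v (index_add \<alpha> \<gamma>) \<sigma>) * T \<gamma> \<alpha> \<sigma>)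
    = ?k / ?D \<gamma> * ?left \<gamma> (lax W N m \<Omega> \<omega> \<kappa> K l z \<Phi>)
    + ?k * \<theta> \<gamma> / ?D \<gamma> * ?right \<gamma> (lax W N m \<Omega> \<omega> \<kappa> K l w \<Phi>)"
    if \<gamma>: "\<gamma> \<in> S" for \<gamma>
  proof -
    have left: "?left \<gamma> (lax W N m \<Omega> \<omega> \<kappa> K l z \<Phi>)
        = ?left \<gamma> K + ?k * (\<Sum>\<alpha>\<in>S. \<Sum>\<sigma>\<in>UNIV. ?u \<alpha> \<sigma> * T \<gamma> \<alpha> \<sigma>)"
      unfolding lax_eq tensor_comm_left_add tensor_comm_left_scale tensor_comm_left_sum T_def U_def ..
    have U_add: "U (index_add \<gamma> \<alpha>) \<sigma> ** P \<gamma> = P \<gamma> ** U \<alpha> \<sigma>" for \<alpha> \<sigma>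
      unfolding U_def lax_term_up_to_sign[OF mat_pow_index_add]
      by (rule lax_term_equivariant[OF mat_pow_symplectic])
    have right_term: "?right \<gamma> (U (index_add \<gamma> \<alpha>) \<sigma>) = - T \<gamma> \<alpha> \<sigma>" for \<alpha> \<sigma>
      unfolding T_def
      by (rule r_core_intertwines[OF mat_pow_symplectic _ U_add[symmetric]])
        (simp add: U_def lax_term_sp_algebra)
    have "?right \<gamma> (lax W N m \<Omega> \<omega> \<kappa> K l w \<Phi>)
        = ?right \<gamma> K + ?k * (\<Sum>\<beta>\<in>S. \<Sum>\<sigma>\<in>UNIV. ?v \<beta> \<sigma> * ?right \<gamma> (U \<beta> \<sigma>))"
      unfolding lax_eq tensor_comm_right_add tensor_comm_right_scale tensor_comm_right_sum U_def ..
    \<comment> \<open>Shifting the index by \<gamma> expresses the right commutators through the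
      same quantities \<open>T\<close> as the left ones.\<close>
    also have "\<dots> = ?right \<gamma> K + ?k * (\<Sum>\<alpha>\<in>S. \<Sum>\<sigma>\<in>UNIV. ?v (index_add \<gamma> \<alpha>) \<sigma> * - T \<gamma> \<alpha> \<sigma>)"
      by (subst sum_index_add[OF \<gamma>]) (simp only: right_term)
    finally have right: "?right \<gamma> (lax W N m \<Omega> \<omega> \<kappa> K l w \<Phi>)
        = ?right \<gamma> K - ?k * (\<Sum>\<alpha>\<in>S. \<Sum>\<sigma>\<in>UNIV. ?v (index_add \<alpha> \<gamma>) \<sigma> * T \<gamma> \<alpha> \<sigma>)"
      by (simp add: sum_negf index_add_commute[of \<gamma>])
    have K_term: "\<theta> \<gamma> * ?right \<gamma> K = - ?left \<gamma> K"
      using D1_tensor_comm[OF K mat_pow_in mat_pow_symplectic, of \<gamma>] char_pow_nonzero[of \<gamma>]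
      by (simp add: \<omega>_mat_pow)
    have split: "?k\<^sup>2 * (?u \<alpha> \<sigma> * ?v (index_add \<alpha> \<gamma>) \<sigma>) * T \<gamma> \<alpha> \<sigma>
        = ?k\<^sup>2 / ?D \<gamma> * (?u \<alpha> \<sigma> * T \<gamma> \<alpha> \<sigma>)
          - ?k\<^sup>2 / ?D \<gamma> * \<theta> \<gamma> * (?v (index_add \<alpha> \<gamma>) \<sigma> * T \<gamma> \<alpha> \<sigma>)" if "\<alpha> \<in> S" for \<alpha> \<sigma>
    proof -
      have \<theta>: "\<theta> (index_add \<alpha> \<gamma>) = \<theta> \<gamma> * \<theta> \<alpha>" by (simp add: char_pow_index_add)
      have "?u \<alpha> \<sigma> * ?v (index_add \<alpha> \<gamma>) \<sigma>
          = 1 / ?D \<gamma> * (?u \<alpha> \<sigma> - \<theta> \<gamma> * ?v (index_add \<alpha> \<gamma>) \<sigma>)"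
        using bracket_coefficient_split[of z "\<theta> \<alpha>" "of_real (l \<sigma>)" w "\<theta> \<gamma>"]
          z[OF that, of \<sigma>] w[OF index_add_in[OF that], of \<gamma> \<sigma>] zw[OF \<gamma>]
        by (simp add: \<theta>)
      then show ?thesis by (simp only:) (simp add: algebra_simps)
    qed
    have "(\<Sum>\<alpha>\<in>S. \<Sum>\<sigma>\<in>UNIV. ?k\<^sup>2 * (?u \<alpha> \<sigma> * ?v (index_add \<alpha> \<gamma>) \<sigma>) * T \<gamma> \<alpha> \<sigma>)
      = ?k\<^sup>2 / ?D \<gamma> * (\<Sum>\<alpha>\<in>S. \<Sum>\<sigma>\<in>UNIV. ?u \<alpha> \<sigma> * T \<gamma> \<alpha> \<sigma>)
        - ?k\<^sup>2 / ?D \<gamma> * \<theta> \<gamma> * (\<Sum>\<alpha>\<in>S. \<Sum>\<sigma>\<in>UNIV. ?v (index_add \<alpha> \<gamma>) \<sigma> * T \<gamma> \<alpha> \<sigma>)"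
      unfolding sum_distrib_left sum_subtractf[symmetric]
      by (intro sum.cong refl split)
    \<comment> \<open>\<open>L\<close> and \<open>R\<close> stand for the two commutators with
      \<open>K\<close>; by \<open>K_term\<close> they cancel, leaving just the two partial
      fractions.\<close>
    moreover have "?k / D * (L + ?k * A) + ?k * t / D * (R - ?k * B)
        = ?k\<^sup>2 / D * A - ?k\<^sup>2 / D * t * B"
      if "t * R = - L" for D L A t R B :: complex
    proof -
      have "?k / D * (L + ?k * A) + ?k * t / D * (R - ?k * B)
          = ?k / D * (L + t * R) + ?k\<^sup>2 / D * A - ?k\<^sup>2 / D * t * B"
        by (simp add: algebra_simps add_divide_distrib diff_divide_distrib power2_eq_square)
      then show ?thesis by (simp add: that)
    qed
    ultimately show ?thesis
      unfolding left right using K_term by simp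
  qed
  show ?thesis
    unfolding lhs r1_eq r2_eq tensor_comm_sum_left sum.distrib[symmetric]
    by (intro sum.cong refl per_index)
qed

end

text \<open>The antecedent keeps both arguments away from the poles of the Lax matrix, and the
  condition relating \<open>w\<close> and \<open>z\<close> keeps them away from those of the
  r-matrices. The relation between \<open>r2\<close> and \<open>r1\<close> stands outside the
  antecedent.\<close>

theorem theorem4:
  fixes n N :: nat
    and W :: "real^'m^'m"
    and G0 :: "(complex^'m^'m) set"
    and \<Omega> :: "nat \<Rightarrow> complex^'m^'m"
    and m :: "nat \<Rightarrow> nat"
    and \<omega> :: "complex^'m^'m \<Rightarrow> complex"
    and l :: "'r::finite \<Rightarrow> real"
    and \<kappa> :: real
    and K :: "complex^'m^'m"
    and z w :: complex
    and \<Phi> :: "real^'r^'m"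
    and a b c d :: 'm
  assumes "CARD('m) = 2 * n"
    and "invertible W" and "transpose W = - W"
    and "subgroup G0 (sp_group W)" and "finite G0"
    and "\<And>A. A \<in> G0 \<Longrightarrow> map_matrix cnj A ** A = mat 1 \<or> map_matrix cnj A ** A = - mat 1"
    and "\<And>i. i \<in> {1..N} \<Longrightarrow> \<Omega> i \<in> G0"
    and "generate (proj_group W) (pr W ` \<Omega> ` {1..N}) = pr W ` G0"
    and "\<And>i. i \<in> {1..N} \<Longrightarrow> m i = group.ord (proj_group W) (pr W (\<Omega> i))"
    and "\<omega> \<in> hom (sp_group W\<lparr>carrier := G0\<rparr>) circle_group"
    and "\<And>A. A \<in> G0 \<Longrightarrow> A \<in> plus_minus_one \<Longrightarrow> \<omega> A = 1"
    and "\<And>\<sigma>. l \<sigma> \<noteq> 0" and "inj (\<lambda>\<sigma>. (l \<sigma>)\<^sup>2)"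
    and "K \<in> D1 W G0 \<omega>"
    and "\<And>\<gamma>. \<gamma> \<in> multi_indices N m \<Longrightarrow> w \<noteq> char_pow N \<Omega> \<omega> \<gamma> * z"
  shows "((\<forall>\<alpha>\<in>multi_indices N m. \<forall>\<sigma>.
             z \<noteq> char_pow N \<Omega> \<omega> \<alpha> * of_real (l \<sigma>) \<and>
             w \<noteq> char_pow N \<Omega> \<omega> \<alpha> * of_real (l \<sigma>)) \<longrightarrow>
          poisson W (\<lambda>\<Phi>. lax W N m \<Omega> \<omega> \<kappa> K l z \<Phi> $ a $ b)
                    (\<lambda>\<Phi>. lax W N m \<Omega> \<omega> \<kappa> K l w \<Phi> $ c $ d) \<Phi> =
            tensor_comm (r1 W N m \<Omega> \<omega> \<kappa> z w)
              (tensor_mat (lax W N m \<Omega> \<omega> \<kappa> K l z \<Phi>) (mat 1)) a b c d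
            + tensor_comm (r2 W N m \<Omega> \<omega> \<kappa> z w)
              (tensor_mat (mat 1) (lax W N m \<Omega> \<omega> \<kappa> K l w \<Phi>)) a b c d)
         \<and> r2 W N m \<Omega> \<omega> \<kappa> z w a b c d = - r1 W N m \<Omega> \<omega> \<kappa> w z c d a b"
proof -
  interpret reduction_group W G0 N m \<Omega> \<omega>
    by (intro reduction_group.intro symplectic_form.intro reduction_group_axioms.intro) (fact assms)+
  show ?thesis
    using lax_poisson_bracket[OF assms(14,15)] r2_eq_minus_r1 by blast
qed

end
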